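(* Let $D=\prod_{i\in I}D_i$ be a product of nontrivial discrete Abelian groups, where $|I|>\omega$, and let $\Pi=PD$. Then $\Pi$ is a nondiscrete $P$-group, $\Pi^\wedge$ is a noncompact $\omega$-bounded group, and both $\Pi$ and $\Pi^\wedge$ are reflexive.
   Context: $\mathbb T=\{z\in\mathbb C:|z|=1\}$ is the circle group. For a topological Abelian group $G$, $G^\wedge$ is the group of continuous characters (continuous homomorphisms $G\to\mathbb T$) with the topology of uniform convergence on compact subsets of $G$. $G$ is reflexive if the evaluation homomorphism $\alpha_G:G\to G^{\wedge\wedge}$, $\alpha_G(x)(\chi)=\chi(x)$, is a topological isomorphism of $G$ onto $G^{\wedge\wedge}=(G^\wedge)^\wedge$. A $P$-group is a topological group in which every $G_\delta$-set is open. A topological group is $\omega$-bounded if the closure of every countable subset is compact. For a topological group $H$, $PH$ ($P$-modification) is the same group with the finer group topology whose base consists of all $G_\delta$-sets of $H$. $D=\prod_{i\in I}D_i$ carries the Tychonoff product topology, and $PD$ is the $P$-modification of this product. *)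

theory Defs
  imports "HOL-Analysis.Analysis" "HOL-Algebra.Product_Groups"
begin

(* A topological group is a pair of an algebraic group G and a topology T on its carrier.
   No separation axiom is included. *)
definition topological_group :: "('a, 'b) monoid_scheme \<Rightarrow> 'a topology \<Rightarrow> bool" where
  "topological_group G T \<longleftrightarrow>
     group G \<and> topspace T = carrier G \<and>
     continuous_map (prod_topology T T) T (\<lambda>(x, y). x \<otimes>\<^bsub>G\<^esub> y) \<and>
     continuous_map T T (\<lambda>x. inv\<^bsub>G\<^esub> x)"

definition P_group :: "('a, 'b) monoid_scheme \<Rightarrow> 'a topology \<Rightarrow> bool" where
  "P_group G T \<longleftrightarrow> topological_group G T \<and> (\<forall>S. gdelta_in T S \<longrightarrow> openin T S)"

definition omega_bounded_group :: "('a, 'b) monoid_scheme \<Rightarrow> 'a topology \<Rightarrow> bool" where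
  "omega_bounded_group G T \<longleftrightarrow>
     topological_group G T \<and>
     (\<forall>C. C \<subseteq> carrier G \<and> countable C \<longrightarrow> compactin T (T closure_of C))"

definition P_modification :: "'a topology \<Rightarrow> 'a topology" where
  "P_modification T = topology (arbitrary union_of (gdelta_in T))"

lemma openin_P_modification:
  "openin (P_modification T) = arbitrary union_of (gdelta_in T)"
  unfolding P_modification_def
  using istopology_base[of "gdelta_in T", OF gdelta_in_Int] by (rule topology_inverse')

lemma topspace_P_modification [simp]: "topspace (P_modification T) = topspace T"
proof
  have "openin (P_modification T) (topspace T)"
    unfolding openin_P_modification by (rule arbitrary_union_of_inc) simp
  then show "topspace T \<subseteq> topspace (P_modification T)" by (rule openin_subset)
  have "(arbitrary union_of (gdelta_in T)) (topspace (P_modification T))"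
    unfolding openin_P_modification[symmetric] by (rule openin_topspace)
  then obtain \<U> where "\<U> \<subseteq> Collect (gdelta_in T)" "\<Union>\<U> = topspace (P_modification T)"
    by (auto simp: union_of_def)
  moreover from this(1) have "\<Union>\<U> \<subseteq> topspace T" by (auto dest: gdelta_in_subset)
  ultimately show "topspace (P_modification T) \<subseteq> topspace T" by simp
qed

definition circle_group :: "complex monoid" where
  "circle_group = \<lparr>carrier = sphere 0 1, mult = (*), one = 1\<rparr>"

(* Functions on a carrier are made extensional so that distinct elements of the dual group
   differ somewhere on the carrier. *)
definition characters :: "('a, 'b) monoid_scheme \<Rightarrow> 'a topology \<Rightarrow> ('a \<Rightarrow> complex) set" where
  "characters G T =
     {f \<in> extensional (carrier G). f \<in> hom G circle_group \<and>
        continuous_map T (top_of_set (carrier circle_group)) f}"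

definition dual_group :: "('a, 'b) monoid_scheme \<Rightarrow> 'a topology \<Rightarrow> ('a \<Rightarrow> complex) monoid" where
  "dual_group G T =
     \<lparr>carrier = characters G T,
      mult = (\<lambda>f g. \<lambda>x\<in>carrier G. f x \<otimes>\<^bsub>circle_group\<^esub> g x),
      one = (\<lambda>x\<in>carrier G. \<one>\<^bsub>circle_group\<^esub>)\<rparr>"

(* Uniform convergence on compact sets: the sets
   {g. \<forall>x\<in>K. dist (g x) (f x) < e}, for K compact and e > 0, form a neighbourhood base at f. *)
definition dual_topology :: "('a, 'b) monoid_scheme \<Rightarrow> 'a topology \<Rightarrow> ('a \<Rightarrow> complex) topology" where
  "dual_topology G T = topology (\<lambda>U. U \<subseteq> characters G T \<and>
     (\<forall>f\<in>U. \<exists>K e. compactin T K \<and> e > 0 \<and>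
        {g \<in> characters G T. \<forall>x\<in>K. dist (g x) (f x) < e} \<subseteq> U))"

lemma openin_dual_topology:
  "openin (dual_topology G T) U \<longleftrightarrow> U \<subseteq> characters G T \<and>
     (\<forall>f\<in>U. \<exists>K e. compactin T K \<and> e > 0 \<and>
        {g \<in> characters G T. \<forall>x\<in>K. dist (g x) (f x) < e} \<subseteq> U)"
proof -
  define N where "N f K e = {g \<in> characters G T. \<forall>x\<in>K. dist (g x) (f x) < e}"
    for f K and e :: real
  define P where "P U \<longleftrightarrow> U \<subseteq> characters G T \<and>
     (\<forall>f\<in>U. \<exists>K e. compactin T K \<and> e > 0 \<and> N f K e \<subseteq> U)" for U
  have "istopology P"
    unfolding istopology_def
  proof (intro conjI allI impI)
    fix S S' assume S: "P S" and S': "P S'"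
    show "P (S \<inter> S')"
      unfolding P_def
    proof (intro conjI ballI)
      show "S \<inter> S' \<subseteq> characters G T" using S P_def by auto
      fix f assume f: "f \<in> S \<inter> S'"
      obtain K e where K: "compactin T K" "e > 0" "N f K e \<subseteq> S" using S f P_def by auto
      obtain K' e' where K': "compactin T K'" "e' > 0" "N f K' e' \<subseteq> S'"
        using S' f P_def by auto
      have "N f (K \<union> K') (min e e') \<subseteq> N f K e \<inter> N f K' e'" by (auto simp: N_def)
      then show "\<exists>K e. compactin T K \<and> e > 0 \<and> N f K e \<subseteq> S \<inter> S'"
        using K K' by (intro exI[of _ "K \<union> K'"] exI[of _ "min e e'"] conjI compactin_Un) auto
    qed
  next
    fix \<K> assume \<K>: "\<forall>U\<in>\<K>. P U"
    show "P (\<Union>\<K>)"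
      unfolding P_def
    proof (intro conjI ballI)
      show "\<Union>\<K> \<subseteq> characters G T" using \<K> P_def by auto
      fix f assume "f \<in> \<Union>\<K>"
      then obtain U where U: "U \<in> \<K>" "f \<in> U" by auto
      then obtain K e where "compactin T K" "e > 0" "N f K e \<subseteq> U"
        using \<K> unfolding P_def by blast
      moreover from U have "U \<subseteq> \<Union>\<K>" by auto
      ultimately show "\<exists>K e. compactin T K \<and> e > 0 \<and> N f K e \<subseteq> \<Union>\<K>" by fast
    qed
  qed
  then have "openin (topology P) U = P U" by simp
  moreover have "dual_topology G T = topology P"
    unfolding dual_topology_def P_def N_def by simp
  ultimately show ?thesis by (simp add: P_def N_def)
qed

lemma topspace_dual_topology [simp]: "topspace (dual_topology G T) = characters G T"
proof
  show "topspace (dual_topology G T) \<subseteq> characters G T"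
    using openin_topspace[of "dual_topology G T"] unfolding openin_dual_topology by (rule conjunct1)
  have "openin (dual_topology G T) (characters G T)"
    unfolding openin_dual_topology
    by (intro conjI ballI exI[of _ "{}"] exI[of _ "1::real"]) auto
  then show "characters G T \<subseteq> topspace (dual_topology G T)" by (rule openin_subset)
qed

definition bidual_group ::
    "('a, 'b) monoid_scheme \<Rightarrow> 'a topology \<Rightarrow> (('a \<Rightarrow> complex) \<Rightarrow> complex) monoid" where
  "bidual_group G T = dual_group (dual_group G T) (dual_topology G T)"

definition bidual_topology ::
    "('a, 'b) monoid_scheme \<Rightarrow> 'a topology \<Rightarrow> (('a \<Rightarrow> complex) \<Rightarrow> complex) topology" where
  "bidual_topology G T = dual_topology (dual_group G T) (dual_topology G T)"

definition evaluation_hom ::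
    "('a, 'b) monoid_scheme \<Rightarrow> 'a topology \<Rightarrow> 'a \<Rightarrow> ('a \<Rightarrow> complex) \<Rightarrow> complex" where
  "evaluation_hom G T x = (\<lambda>f\<in>carrier (dual_group G T). f x)"

definition reflexive_group :: "('a, 'b) monoid_scheme \<Rightarrow> 'a topology \<Rightarrow> bool" where
  "reflexive_group G T \<longleftrightarrow>
     comm_group G \<and> topological_group G T \<and>
     evaluation_hom G T \<in> iso G (bidual_group G T) \<and>
     homeomorphic_map T (bidual_topology G T) (evaluation_hom G T)"

end

theory Submission
  imports Defs "HOL-Library.Countable_Set_Type"
begin

text \<open>Write \<open>U J\<close> for the points of \<open>D\<close> that are trivial on the coordinates in \<open>J\<close>. The subgroups
  \<open>U J\<close> with \<open>J\<close> countable form a base at the identity of \<open>\<Pi>\<close>. Since the circle has no small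
  subgroups, the characters of \<open>\<Pi>\<close> are the homomorphisms that are trivial on some such \<open>U J\<close>;
  since compact subsets of \<open>\<Pi>\<close> are finite, the dual carries the topology of pointwise convergence.
  So the annihilator of \<open>U J\<close> is compact, which gives \<open>\<omega>\<close>-boundedness. Conversely every compact
  set of characters lies in one of these annihilators, and therefore evaluation is a homeomorphism
  onto its image and the dual is not compact.

  Evaluation is onto because a continuous character of the annihilator of \<open>U J\<close> is controlled
  by finitely many points of \<open>D\<close>, which are eliminated one at a time; the points obtained for
  singletons \<open>J = {i}\<close> are the coordinates of the representing point. Finally, the dual of any
  reflexive group is reflexive.\<close>

subsection \<open>The circle group\<close>

text \<open>For countable \<open>J\<close> the group \<open>A J\<close> is the Pontryagin dual of
  the discrete quotient of \<open>G\<close> by \<open>U J\<close>, so representing a character of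
  \<open>A J\<close> by a point is the classical duality between a discrete group and its compact
  dual. It is proved here from scratch: divisibility of the circle supplies characters with
  prescribed values, and a point is eliminated by knowing the continuous endomorphisms of the circle
  and the characters of its finite cyclic subgroups. Quotients are avoided by working with functions
  on \<open>G\<close> that are trivial on a subgroup. The hard part is the continuity of evaluation,
  that is, confining a compact set of characters to a single annihilator. One character depends on
  countably many coordinates, but a compact set might need uncountably many, and no sequence can
  detect this, since every countable set of characters lies in one compact annihilator. The
  contradiction therefore comes from a family of length omega_1, the first length at which each
  stage has countably many predecessors while the whole family is uncountable.\<close>

lemma circle_group_simps [simp]:
  "carrier circle_group = sphere 0 1"
  "x \<otimes>\<^bsub>circle_group\<^esub> y = x * y"
  "\<one>\<^bsub>circle_group\<^esub> = 1"
  by (simp_all add: circle_group_def)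

lemma comm_group_circle: "comm_group circle_group"
proof (rule comm_groupI)
  fix x assume x: "x \<in> carrier circle_group"
  then show "\<exists>y\<in>carrier circle_group. y \<otimes>\<^bsub>circle_group\<^esub> x = \<one>\<^bsub>circle_group\<^esub>"
    by (intro bexI[of _ "inverse x"]) (auto simp: norm_inverse intro!: left_inverse)
qed (auto simp: norm_mult)

section \<open>Absence of small subgroups in the circle\<close>

lemma norm_square_minus_one_ge:
  fixes w :: complex
  assumes "norm w = 1" "norm (w - 1) < 1"
  shows "3/2 * norm (w - 1) \<le> norm (w\<^sup>2 - 1)"
proof -
  have "(Re w)\<^sup>2 + (Im w)\<^sup>2 = 1" using assms(1) cmod_power2[of w] by simp
  then have "(norm (w - 1))\<^sup>2 = 2 - 2 * Re w"
    unfolding cmod_power2 by (simp add: power2_eq_square algebra_simps)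
  \<comment> \<open>Distance below 1 from 1 means \<open>Re w > 1/2\<close>, so the real part of the
    cofactor \<open>w + 1\<close> exceeds 3/2.\<close>
  moreover have "(norm (w - 1))\<^sup>2 < 1" using assms(2) by (simp add: power_less_one_iff)
  ultimately have "norm (w + 1) \<ge> 3/2" using complex_Re_le_cmod[of "w + 1"] by simp
  moreover have "norm (w\<^sup>2 - 1) = norm (w + 1) * norm (w - 1)"
    by (simp add: norm_mult[symmetric] power2_eq_square algebra_simps)
  ultimately show ?thesis using mult_right_mono[of "3/2" "norm (w + 1)" "norm (w - 1)"] by simp
qed

text \<open>Each squaring pushes a unit number away from 1 by the factor 3/2 as long as it is within
  distance 1, so the powers of any \<open>z\<close> other than 1 eventually leave that disc.\<close>

lemma norm_power_minus_one_ge: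
  fixes z :: complex
  assumes "norm z = 1" and "\<And>i. i < k \<Longrightarrow> norm (z ^ 2 ^ i - 1) < 1"
  shows "(3/2) ^ k * norm (z - 1) \<le> norm (z ^ 2 ^ k - 1)"
  using assms(2)
proof (induction k)
  case (Suc k)
  have "3/2 * norm (z ^ 2 ^ k - 1) \<le> norm ((z ^ 2 ^ k)\<^sup>2 - 1)"
    using assms(1) Suc.prems by (intro norm_square_minus_one_ge) (simp_all add: norm_power)
  moreover have "(z ^ 2 ^ k)\<^sup>2 = z ^ 2 ^ Suc k" by (simp add: power_mult[symmetric] mult.commute)
  ultimately show ?case using Suc by simp
qed simp

lemma unit_eq_one_if_powers_near_one:
  fixes z :: complex
  assumes "norm z = 1" and small: "\<And>n::nat. norm (z ^ n - 1) < 1"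
  shows "z = 1"
proof (rule ccontr)
  assume "z \<noteq> 1"
  then have pos: "norm (z - 1) > 0" by simp
  obtain k :: nat where "1 / norm (z - 1) < (3/2) ^ k"
    using real_arch_pow[of "3/2::real"] by auto
  then have "1 < (3/2) ^ k * norm (z - 1)" using pos by (simp add: divide_less_eq)
  then show False using norm_power_minus_one_ge[of z k] assms(1) small[of "2 ^ k"] small by fastforce
qed

lemma norm_mult_minus_one_le:
  fixes w z :: complex
  assumes "norm w = 1"
  shows "norm (w * z - 1) \<le> norm (w - 1) + norm (z - 1)"
proof -
  have "norm (w * z - 1) = norm (w * (z - 1) + (w - 1))" by (simp add: algebra_simps)
  also have "\<dots> \<le> norm (w * (z - 1)) + norm (w - 1)" by (rule norm_triangle_ineq)
  finally show ?thesis using assms by (simp add: norm_mult)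
qed

lemma norm_inverse_minus_one:
  fixes w :: complex
  assumes "norm w = 1"
  shows "norm (inverse w - 1) = norm (w - 1)"
proof -
  have "norm (inverse w - 1) = norm (inverse w * (1 - w))"
  proof -
    have "w \<noteq> 0" using assms by auto
    then show ?thesis by (simp add: right_diff_distrib)
  qed
  then show ?thesis using assms by (simp add: norm_mult norm_inverse norm_minus_commute)
qed

text \<open>On the compact part of the circle at distance at least \<open>e\<close> from all roots,
  \<open>norm (z ^ m - 1)\<close> has a positive minimum. This later replaces an approximate value
  at a point by one that is actually attained.\<close>

lemma near_root_of_unity:
  fixes e :: real
  assumes "m > 0" "e > 0"
  obtains d where "d > 0"
    "\<And>z::complex. norm z = 1 \<Longrightarrow> norm (z ^ m - 1) < d \<Longrightarrow> \<exists>w. w ^ m = 1 \<and> norm (z - w) < e"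
proof -
  define S where "S = sphere 0 1 \<inter> (\<Inter>w\<in>{w::complex. w ^ m = 1}. {z. norm (z - w) \<ge> e})"
  have "closed (\<Inter>w\<in>{w::complex. w ^ m = 1}. {z. norm (z - w) \<ge> e})"
    by (intro closed_INT ballI closed_Collect_le continuous_intros)
  then have S: "compact S" unfolding S_def by (intro compact_Int_closed) auto
  have "\<exists>d>0. \<forall>z\<in>S. norm (z ^ m - 1) \<ge> d"
  proof (cases "S = {}")
    case False
    obtain y where y: "y \<in> S" "\<And>z. z \<in> S \<Longrightarrow> norm (y ^ m - 1) \<le> norm (z ^ m - 1)"
    proof -
      have "continuous_on S (\<lambda>z. norm (z ^ m - 1))" by (intro continuous_intros)
      then show thesis using continuous_attains_inf[OF S False] that by blast
    qed
    have "y ^ m \<noteq> 1" using y(1) \<open>e > 0\<close> unfolding S_def by force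
    then show ?thesis using y(2) by (intro exI[of _ "norm (y ^ m - 1)"]) auto
  qed (auto intro: exI[of _ 1])
  then obtain d where "d > 0" "\<And>z. z \<in> S \<Longrightarrow> norm (z ^ m - 1) \<ge> d" by auto
  then show thesis by (intro that[of d]) (force simp: S_def not_le)+
qed

section \<open>Continuous endomorphisms of the circle\<close>

lemma additive_continuous_imp_linear:
  fixes M :: "real \<Rightarrow> real"
  assumes cont: "continuous_on UNIV M" and add: "\<And>s t. M (s + t) = M s + M t"
  shows "M t = M 1 * t"
proof -
  \<comment> \<open>Subtracting the linear map with the same value at 1 leaves an additive function
    that vanishes on the integers. It has period 1, so it is bounded, and a bounded additive
    function is 0.\<close>
  define h where "h t = M t - M 1 * t" for t
  have hadd: "h (s + t) = h s + h t" for s t by (simp add: h_def add algebra_simps)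
  have h0: "h 0 = 0" using hadd[of 0 0] by simp
  have hn: "h (real n * t) = real n * h t" for n t
    by (induction n) (auto simp: h0 hadd algebra_simps)
  have hneg: "h (- t) = - h t" for t using hadd[of t "- t"] h0 by simp
  have hint: "h (of_int n) = 0" for n
  proof -
    have "h 1 = 0" by (simp add: h_def)
    then have "h (real k) = 0" for k using hn[of k 1] by simp
    then show ?thesis by (cases n) (auto simp: hneg simp del: of_nat_Suc)
  qed
  have "compact (h ` {0..1})"
    unfolding h_def
    by (intro compact_continuous_image continuous_intros continuous_on_subset[OF cont]) auto
  then obtain B where B: "\<And>s. s \<in> {0..1} \<Longrightarrow> \<bar>h s\<bar> \<le> B"
    by (meson bounded_real compact_imp_bounded imageI)
  have bound: "\<bar>h s\<bar> \<le> B" for s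
  proof -
    have "h s = h (frac s)" using hadd[of "of_int \<lfloor>s\<rfloor>" "frac s"] hint[of "\<lfloor>s\<rfloor>"] by (simp add: frac_def)
    then show ?thesis using B[of "frac s"] by (simp add: frac_ge_0 less_imp_le[OF frac_lt_1])
  qed
  have "h t = 0"
  proof (rule ccontr)
    assume "h t \<noteq> 0"
    then obtain n :: nat where "B < real n * \<bar>h t\<bar>"
      using reals_Archimedean3[of "\<bar>h t\<bar>"] by auto
    then show False using bound[of "real n * t"] by (simp add: hn abs_mult)
  qed
  then show ?thesis by (simp add: h_def)
qed

text \<open>Along the covering of the circle by the line, \<open>\<psi>\<close> lifts to a
  continuous function of the angle. The defect of additivity of the lift is continuous with values
  in the multiples of 2 pi, hence constant, so the lift is linear; period 2 pi forces an integer
  slope.\<close>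

lemma circle_endomorphism_eq_power:
  fixes \<psi> :: "complex \<Rightarrow> complex"
  assumes cont: "continuous_on (sphere 0 1) \<psi>"
    and norm: "\<And>z. norm z = 1 \<Longrightarrow> norm (\<psi> z) = 1"
    and mult: "\<And>z w. norm z = 1 \<Longrightarrow> norm w = 1 \<Longrightarrow> \<psi> (z * w) = \<psi> z * \<psi> w"
  shows "\<exists>k::int. \<forall>z. norm z = 1 \<longrightarrow> \<psi> z = z powi k"
proof -
  define g where "g t = \<psi> (cis t)" for t :: real
  have "continuous_on UNIV g"
    unfolding g_def by (intro continuous_on_compose2[OF cont] continuous_intros) auto
  moreover have "g t \<noteq> 0" for t using norm[of "cis t"] by (auto simp: g_def)
  ultimately obtain L0 where L0: "continuous_on UNIV L0" "\<And>t. g t = exp (L0 t)"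
    using continuous_logarithm_on_contractible[of "UNIV::real set" g] contractible_UNIV by auto
  define L where "L t = Im (L0 t)" for t
  have contL: "continuous_on UNIV L" unfolding L_def by (intro continuous_intros L0)
  have g: "g t = cis (L t)" for t
  proof -
    have "norm (g t) = 1" by (simp add: g_def norm)
    then have "Re (L0 t) = 0" by (simp add: L0(2))
    then show ?thesis by (simp add: L0(2) L_def exp_eq_polar)
  qed
  have gadd: "g (s + t) = g s * g t" for s t by (simp add: g_def mult cis_mult[symmetric])
  \<comment> \<open>The logarithm is fixed only up to multiples of 2 pi in its imaginary part; this
    normalises the lift to vanish at 0.\<close>
  define M where "M t = L t - L 0" for t
  have contM: "continuous_on UNIV M" unfolding M_def by (intro continuous_intros contL)
  have "g 0 = 1" using gadd[of 0 0] \<open>g 0 \<noteq> 0\<close> by simp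
  then have c0: "cis (L 0) = 1" by (simp add: g)
  have gM: "g t = cis (M t)" for t
    unfolding M_def by (simp add: g cis_divide[symmetric] c0)
  have Madd: "M (s + t) = M s + M t" for s t
  proof -
    define d where "d u = M (s + u) - M s - M u" for u
    have dint: "\<exists>n::int. d u = 2 * pi * n" for u
    proof -
      have "cis (d u) = 1" unfolding d_def
        by (simp add: cis_divide[symmetric] gM[symmetric] gadd \<open>\<And>t. g t \<noteq> 0\<close>)
      then have "cos (d u) = 1" by (metis cis.sel(1) one_complex.sel(1))
      then show ?thesis by (auto simp: cos_one_2pi_int mult_ac)
    qed
    have contd: "continuous_on UNIV d"
      unfolding d_def by (intro continuous_intros continuous_on_compose2[OF contM]) auto
    have "d constant_on UNIV"
    proof (rule continuous_discrete_range_constant[OF connected_UNIV contd], intro exI conjI allI impI)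
      fix u v :: real
      assume uv: "v \<in> UNIV \<and> d v \<noteq> d u"
      obtain n n' :: int where n: "d u = 2 * pi * n" "d v = 2 * pi * n'" using dint by metis
      then have "\<bar>n' - n\<bar> \<ge> 1" using uv by auto
      then have "\<bar>real_of_int n' - real_of_int n\<bar> \<ge> 1" by linarith
      then have "2 * pi * 1 \<le> 2 * pi * \<bar>real_of_int n' - real_of_int n\<bar>"
        by (intro mult_left_mono) auto
      also have "\<dots> = norm (d v - d u)"
        by (simp add: n right_diff_distrib[symmetric] abs_mult)
      finally show "2 * pi \<le> norm (d v - d u)" by simp
    qed simp
    then have "d t = d 0" by (auto simp: constant_on_def)
    then show ?thesis by (simp add: d_def M_def)
  qed
  define c where "c = M 1"
  have c: "M t = c * t" for t
    unfolding c_def by (rule additive_continuous_imp_linear[OF contM Madd])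
  have "cis (c * (2 * pi)) = 1" using gM[of "2*pi"] \<open>g 0 = 1\<close> by (simp add: c g_def)
  then obtain k :: int where "c * (2 * pi) = 2 * pi * k"

  proof -
    have "cos (c * (2 * pi)) = 1" using \<open>cis (c * (2 * pi)) = 1\<close> by (metis cis.sel(1) one_complex.sel(1))
    then obtain k :: int where "c * (2 * pi) = real_of_int k * 2 * pi" by (auto simp: cos_one_2pi_int)
    then show thesis by (intro that[of k]) simp
  qed
  then have "c = k" by simp
  have "\<psi> z = z powi k" if "norm z = 1" for z
  proof -
    have "z = cis (Arg z)" using that
      by (metis rcis_cmod_Arg cis_rcis_eq)
    then have "\<psi> z = cis (k * Arg z)" using gM[of "Arg z"] c \<open>c = k\<close> by (metis g_def)
    also have "\<dots> = cis (Arg z) powi k" by (simp add: cis_power_int)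
    finally show ?thesis using \<open>z = cis (Arg z)\<close> by simp
  qed
  then show ?thesis by blast
qed

subsection \<open>Extension of characters\<close>

text \<open>Subgroups of the integers are cyclic, generated by their least positive member. The
  trivial subgroup gets \<open>d = 0\<close>, because \<open>0 dvd a\<close> means
  \<open>a = 0\<close>; this lets \<open>d = 0\<close> stand for infinite order below.\<close>

lemma int_set_eq_multiples:
  fixes M :: "int set"
  assumes "0 \<in> M" and diff: "\<And>a b. a \<in> M \<Longrightarrow> b \<in> M \<Longrightarrow> a - b \<in> M"
  obtains d :: nat where "\<And>a. a \<in> M \<longleftrightarrow> int d dvd a"
proof (cases "M = {0}")
  case True
  then show thesis using that[of 0] by simp
next
  case False
  then obtain a where a: "a \<in> M" "a \<noteq> 0" using \<open>0 \<in> M\<close> by auto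
  have neg: "- a \<in> M" if "a \<in> M" for a using diff[OF \<open>0 \<in> M\<close> that] by simp
  have add: "a + b \<in> M" if "a \<in> M" "b \<in> M" for a b using diff[OF that(1) neg[OF that(2)]] by simp
  define d where "d = (LEAST n::nat. n > 0 \<and> int n \<in> M)"
  have "nat \<bar>a\<bar> > 0 \<and> int (nat \<bar>a\<bar>) \<in> M" using a neg by (auto simp: abs_if)
  then have d: "d > 0" "int d \<in> M" unfolding d_def by (metis (mono_tags, lifting) LeastI)+
  have least: "n \<ge> d" if "n > 0" "int n \<in> M" for n
    unfolding d_def using that by (auto intro: Least_le)
  have mult_nat: "int d * int k \<in> M" for k
  proof (induction k)
    case (Suc k)
    then show ?case using add[OF d(2) Suc] by (simp add: algebra_simps)
  qed (simp add: \<open>0 \<in> M\<close>)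
  have mult: "int d * k \<in> M" for k
  proof (cases "k \<ge> 0")
    case True
    then show ?thesis using mult_nat[of "nat k"] by simp
  next
    case False
    then show ?thesis using neg[OF mult_nat[of "nat (- k)"]] by simp
  qed
  have "int d dvd b" if "b \<in> M" for b
  proof (rule ccontr)
    assume "\<not> int d dvd b"
    then have "b mod int d \<noteq> 0" by (simp add: dvd_eq_mod_eq_0)
    moreover have "b mod int d \<ge> 0" "b mod int d < int d"
      using d(1) by simp_all
    moreover have "b mod int d \<in> M"
      using diff[OF that mult[of "b div int d"]] by (simp add: minus_mult_div_eq_mod)
    ultimately show False using least[of "nat (b mod int d)"] by simp
  qed
  then show thesis using that[of d] mult by (auto simp: dvd_def)
qed

text \<open>\<open>d\<close> is the order of \<open>x\<close> modulo \<open>H\<close>, with 0 for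
  infinite order.\<close>

lemma subgroup_int_pow_multiples:
  assumes "group G" "subgroup H G" "x \<in> carrier G"
  obtains d :: nat where "\<And>k::int. x [^]\<^bsub>G\<^esub> k \<in> H \<longleftrightarrow> int d dvd k"
proof -
  interpret group G by fact
  interpret H: subgroup H G by fact
  obtain d where "\<And>k. k \<in> {k. x [^]\<^bsub>G\<^esub> k \<in> H} \<longleftrightarrow> int d dvd k"
    by (rule int_set_eq_multiples[of "{k. x [^]\<^bsub>G\<^esub> k \<in> H}"])
      (use assms in \<open>auto simp: int_pow_diff\<close>)
  then show thesis using that by auto
qed

text \<open>Partial characters are handled as single-valued subgroups of \<open>G \<times> \<complex>\<^sup>\<times>\<close>, which makes
  unions of chains and extensions by one element easy to verify.\<close>

definition partial_char :: "('a, 'b) monoid_scheme \<Rightarrow> ('a \<times> complex) set \<Rightarrow> bool" where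
  "partial_char G R \<longleftrightarrow> R \<subseteq> carrier G \<times> sphere 0 1 \<and> (\<one>\<^bsub>G\<^esub>, 1) \<in> R \<and>
     (\<forall>a u b v. (a, u) \<in> R \<longrightarrow> (b, v) \<in> R \<longrightarrow> (a \<otimes>\<^bsub>G\<^esub> inv\<^bsub>G\<^esub> b, u * inverse v) \<in> R) \<and>
     (\<forall>w. (\<one>\<^bsub>G\<^esub>, w) \<in> R \<longrightarrow> w = 1)"

context comm_group begin

lemma partial_charD:
  assumes "partial_char G R"
  shows "(a, u) \<in> R \<Longrightarrow> a \<in> carrier G" "(a, u) \<in> R \<Longrightarrow> norm u = 1" "(\<one>, 1) \<in> R"
    "(a, u) \<in> R \<Longrightarrow> (b, v) \<in> R \<Longrightarrow> (a \<otimes> inv b, u * inverse v) \<in> R"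
    "(\<one>, w) \<in> R \<Longrightarrow> w = 1"
  using assms unfolding partial_char_def by auto

lemma partial_char_inv:
  assumes "partial_char G R" "(a, u) \<in> R"
  shows "(inv a, inverse u) \<in> R"
  using partial_charD(4)[OF assms(1) partial_charD(3)[OF assms(1)] assms(2)]
    partial_charD(1)[OF assms] by simp

lemma partial_char_mult:
  assumes "partial_char G R" "(a, u) \<in> R" "(b, v) \<in> R"
  shows "(a \<otimes> b, u * v) \<in> R"
  using partial_charD(4)[OF assms(1,2) partial_char_inv[OF assms(1,3)]]
    partial_charD(1)[OF assms(1,3)] by simp

lemma partial_char_unique:
  assumes "partial_char G R" "(a, u) \<in> R" "(a, v) \<in> R"
  shows "u = v"
proof -
  have "u * inverse v = 1"
    using partial_charD(4)[OF assms] partial_charD(1)[OF assms(1,2)] partial_charD(5)[OF assms(1)] by simp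
  moreover have "v \<noteq> 0" using partial_charD(2)[OF assms(1,3)] by auto
  ultimately show ?thesis by (simp add: field_simps)
qed

lemma partial_char_nat_pow:
  assumes "partial_char G R" "(a, u) \<in> R"
  shows "(a [^] (n::nat), u ^ n) \<in> R"
proof (induction n)
  case (Suc n)
  show ?case using partial_char_mult[OF assms(1) Suc assms(2)] by (simp add: mult.commute)
qed (use partial_charD(3)[OF assms(1)] in simp)

lemma partial_char_int_pow:
  assumes "partial_char G R" "(a, u) \<in> R"
  shows "(a [^] (k::int), u powi k) \<in> R"
proof (cases k rule: int_cases2)
  case (nonneg n)
  then show ?thesis using partial_char_nat_pow[OF assms, of n] by (simp add: int_pow_int)
next
  case (nonpos n)
  then show ?thesis
    using partial_char_inv[OF assms(1) partial_char_nat_pow[OF assms, of n]] partial_charD(1)[OF assms]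
    by (simp add: int_pow_neg_int power_int_minus)
qed

text \<open>The first components of \<open>R'\<close> form the subgroup generated by the domain of
  \<open>R\<close> and \<open>x\<close>. Single-valuedness has to be checked only at the identity,
  where it reduces to \<open>compat\<close>.\<close>

lemma partial_char_extend:
  assumes R: "partial_char G R" and x: "x \<in> carrier G" and z: "norm z = 1"
    and compat: "\<And>(k::int) u. (x [^] k, u) \<in> R \<Longrightarrow> u = z powi k"
  defines "R' \<equiv> {(a \<otimes> x [^] k, u * z powi k) | a u (k::int). (a, u) \<in> R}"
  shows "partial_char G R'" "R \<subseteq> R'" "(x, z) \<in> R'"
proof -
  note D = partial_charD[OF R]
  have z0: "z \<noteq> 0" using z by auto
  have incl: "(a, u) \<in> R'" if "(a, u) \<in> R" for a u
    unfolding R'_def using that D(1)[OF that] by (force intro!: exI[of _ a] exI[of _ u] exI[of _ "0::int"])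
  then show "R \<subseteq> R'" by auto
  show "(x, z) \<in> R'"
    unfolding R'_def using D(3) x by (force intro!: exI[of _ "\<one>"] exI[of _ "1"] exI[of _ "1::int"])
  show "partial_char G R'"
    unfolding partial_char_def
  proof (intro conjI allI impI)
    show "R' \<subseteq> carrier G \<times> sphere 0 1"
      using D(1,2) x z by (auto simp: R'_def norm_mult norm_power_int)
    show "(\<one>, 1) \<in> R'" using incl D(3) by auto
  next
    fix a u b v assume "(a, u) \<in> R'" "(b, v) \<in> R'"
    then obtain a' u' b' v' and k l :: int where *: "a = a' \<otimes> x [^] k" "u = u' * z powi k" "(a', u') \<in> R"
      "b = b' \<otimes> x [^] l" "v = v' * z powi l" "(b', v') \<in> R" unfolding R'_def by blast
    have car: "a' \<in> carrier G" "b' \<in> carrier G" using * D(1) by auto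
    have "(a' \<otimes> inv b', u' * inverse v') \<in> R" using * D(4) by auto
    moreover have "a \<otimes> inv b = (a' \<otimes> inv b') \<otimes> x [^] (k - l)"
      using car x by (simp add: * int_pow_diff inv_mult m_ac)
    moreover have "u * inverse v = (u' * inverse v') * z powi (k - l)"
      using z0 by (simp add: * power_int_diff field_simps)
    ultimately show "(a \<otimes> inv b, u * inverse v) \<in> R'" unfolding R'_def by blast
  next
    fix w assume "(\<one>, w) \<in> R'"
    then obtain a u and k :: int where *: "\<one> = a \<otimes> x [^] k" "w = u * z powi k" "(a, u) \<in> R"
      unfolding R'_def by blast
    \<comment> \<open>So \<open>x [^] k\<close> lies in the domain of \<open>R\<close>, and
      \<open>compat\<close> applies to it.\<close>
    have "inv a = x [^] k" using * D(1) x by (metis int_pow_closed inv_comm inv_equality)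
    then have "inverse u = z powi k" using compat[of k "inverse u"] partial_char_inv[OF R *(3)] by simp
    moreover have "u \<noteq> 0" using D(2)[OF *(3)] by auto
    ultimately show "w = 1" using *(2) right_inverse[of u] by simp
  qed
qed

text \<open>This is the divisibility of the circle: if \<open>d\<close> generates the exponents that
  bring \<open>x\<close> into the domain of \<open>R\<close>, any \<open>d\<close>-th root of the
  value at \<open>x [^] d\<close> is a consistent value at \<open>x\<close>. For
  \<open>d = 0\<close> the value 1 is chosen.\<close>

lemma partial_char_divide:
  assumes R: "partial_char G R" and x: "x \<in> carrier G"
  obtains z where "norm z = 1" "\<And>(k::int) u. (x [^] k, u) \<in> R \<Longrightarrow> u = z powi k"
proof -
  note D = partial_charD[OF R]
  obtain d where d: "\<And>k::int. k \<in> {k. \<exists>u. (x [^] k, u) \<in> R} \<longleftrightarrow> int d dvd k"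
  proof (rule int_set_eq_multiples[of "{k::int. \<exists>u. (x [^] k, u) \<in> R}"])
    show "0 \<in> {k::int. \<exists>u. (x [^] k, u) \<in> R}" using D(3) by auto
    show "a - b \<in> {k. \<exists>u. (x [^] k, u) \<in> R}"
      if ab: "a \<in> {k. \<exists>u. (x [^] k, u) \<in> R}" "b \<in> {k. \<exists>u. (x [^] k, u) \<in> R}" for a b :: int
    proof -
      obtain u v where "(x [^] a, u) \<in> R" "(x [^] b, v) \<in> R" using ab by auto
      then have "(x [^] (a - b), u * inverse v) \<in> R" using D(4) x by (simp add: int_pow_diff)
      then show ?thesis by blast
    qed
  qed blast
  obtain v where v: "(x [^] int d, v) \<in> R" using d[of "int d"] by auto
  have "\<exists>z. norm z = 1 \<and> z ^ d = v"
  proof (cases "d = 0")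
    case True
    then have "v = 1" using v D(5) by simp
    then show ?thesis using True by (intro exI[of _ 1]) simp
  next
    case False
    obtain t where "v = cis t" using D(2)[OF v] by (metis rcis_cmod_Arg cis_rcis_eq)
    moreover have "cis (t / d) ^ d = cis t" using False by (subst Complex.DeMoivre) simp
    ultimately show ?thesis by (intro exI[of _ "cis (t / d)"]) simp
  qed
  then obtain z where z: "norm z = 1" "z ^ d = v" by auto
  have "u = z powi k" if ku: "(x [^] k, u) \<in> R" for k u
  proof -
    obtain j where j: "k = int d * j" using d[of k] ku by auto
    have "(x [^] k, v powi j) \<in> R"
      using partial_char_int_pow[OF R v, of j] x by (simp add: j int_pow_pow)
    then have "u = v powi j" using partial_char_unique[OF R ku] by simp
    then show ?thesis using z by (simp add: j power_int_mult)
  qed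
  then show thesis using that z by blast
qed

text \<open>A maximal extension from Zorn's lemma is total: \<open>partial_char_divide\<close> finds
  an admissible value at any missing point and \<open>partial_char_extend\<close> adds it.\<close>

lemma partial_char_total:
  assumes "partial_char G R"
  obtains f where "f \<in> hom G circle_group" "\<And>a u. (a, u) \<in> R \<Longrightarrow> f a = u"
proof -
  define \<P> where "\<P> = {S. partial_char G S \<and> R \<subseteq> S}"
  have "\<exists>M\<in>\<P>. \<forall>S\<in>\<P>. M \<subseteq> S \<longrightarrow> S = M"
  proof (rule subset_Zorn_nonempty)
    show "\<P> \<noteq> {}" using assms by (auto simp: \<P>_def)
    fix \<C> assume \<C>: "\<C> \<noteq> {}" "subset.chain \<P> \<C>"
    then have sub: "\<And>S. S \<in> \<C> \<Longrightarrow> partial_char G S \<and> R \<subseteq> S"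
      by (auto simp: subset.chain_def \<P>_def)
    have "partial_char G (\<Union>\<C>)"
      unfolding partial_char_def
    proof (intro conjI allI impI)
      fix a u b v assume "(a, u) \<in> \<Union>\<C>" "(b, v) \<in> \<Union>\<C>"
      then obtain S1 S2 where S: "S1 \<in> \<C>" "S2 \<in> \<C>" "(a, u) \<in> S1" "(b, v) \<in> S2" by auto
      then have "S1 \<subseteq> S2 \<or> S2 \<subseteq> S1" using \<C>(2) by (auto simp: subset.chain_def)
      then show "(a \<otimes> inv b, u * inverse v) \<in> \<Union>\<C>"
        using S sub partial_charD(4) by (meson UnionI subsetD)
    qed (use sub partial_charD \<C>(1) in \<open>fastforce+\<close>)
    then show "\<Union>\<C> \<in> \<P>" using sub \<C>(1) by (auto simp: \<P>_def)
  qed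
  then obtain M where M: "partial_char G M" "R \<subseteq> M"
    and max: "\<And>S. partial_char G S \<Longrightarrow> M \<subseteq> S \<Longrightarrow> S = M" unfolding \<P>_def by auto
  have total: "\<exists>u. (x, u) \<in> M" if x: "x \<in> carrier G" for x
  proof -
    obtain z where z: "norm z = 1" "\<And>(k::int) u. (x [^] k, u) \<in> M \<Longrightarrow> u = z powi k"
      using partial_char_divide[OF M(1) x] by blast
    show ?thesis using partial_char_extend[OF M(1) x z] max by blast
  qed
  define f where "f x = (SOME u. (x, u) \<in> M)" for x
  have f: "(x, f x) \<in> M" if "x \<in> carrier G" for x unfolding f_def using total[OF that] by (rule someI_ex)
  have feq: "f a = u" if "(a, u) \<in> M" for a u
    using partial_char_unique[OF M(1) f that] partial_charD(1)[OF M(1) that] by blast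
  have "f \<in> hom G circle_group"
  proof (rule homI)
    show "f x \<in> carrier circle_group" if "x \<in> carrier G" for x
      using partial_charD(2)[OF M(1) f[OF that]] by simp
    show "f (x \<otimes> y) = f x \<otimes>\<^bsub>circle_group\<^esub> f y" if "x \<in> carrier G" "y \<in> carrier G" for x y
      using feq[OF partial_char_mult[OF M(1) f f]] that by simp
  qed
  then show thesis using that feq M(2) by blast
qed

text \<open>The partial character \<open>H \<times> {1}\<close> is extended to \<open>x\<close> and
  then to \<open>G\<close>. The freedom to prescribe \<open>z\<close>, rather than only to avoid 1,
  is what the elimination of a point needs.\<close>

lemma character_trivial_on_subgroup:
  assumes H: "subgroup H G" and x: "x \<in> carrier G" and z: "norm z = 1"
    and compat: "\<And>k::int. x [^] k \<in> H \<Longrightarrow> z powi k = 1"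
  obtains f where "f \<in> hom G circle_group" "\<And>h. h \<in> H \<Longrightarrow> f h = 1" "f x = z"
proof -
  interpret H: subgroup H G by fact
  have R: "partial_char G (H \<times> {1})" by (auto simp: partial_char_def)
  have eq: "u = z powi k" if "(x [^] k, u) \<in> H \<times> {1}" for k :: int and u
    using that compat[of k] by (metis mem_Sigma_iff singletonD)
  note ext = partial_char_extend[OF R x z eq]
  obtain f where f: "f \<in> hom G circle_group"
    "\<And>a u. (a, u) \<in> {(a \<otimes> x [^] k, u * z powi k) |a u (k::int). (a, u) \<in> H \<times> {1}} \<Longrightarrow> f a = u"
    using partial_char_total[OF ext(1)] by blast
  show thesis
  proof (rule that[OF f(1)])
    show "f h = 1" if "h \<in> H" for h using ext(2) that by (intro f(2)) blast
    show "f x = z" using ext(3) by (intro f(2)) blast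
  qed
qed

lemma character_separates:
  assumes H: "subgroup H G" and x: "x \<in> carrier G" "x \<notin> H"
  obtains f where "f \<in> hom G circle_group" "\<And>h. h \<in> H \<Longrightarrow> f h = 1" "f x \<noteq> 1"
proof -
  obtain d where d: "\<And>k::int. x [^] k \<in> H \<longleftrightarrow> int d dvd k"
    using subgroup_int_pow_multiples[OF is_group H x(1)] by blast
  have "d \<noteq> 1" using d[of 1] x by auto
  \<comment> \<open>An element of order \<open>d\<close> modulo \<open>H\<close> may be sent to a
    primitive \<open>d\<close>-th root of unity. For infinite order every unit number is allowed,
    and -1 is one that differs from 1.\<close>
  define z where "z = (if d = 0 then -1 else cis (2 * pi / d))"
  have "z \<noteq> 1"
  proof (cases "d = 0")
    case False
    then have "d \<ge> 2" using \<open>d \<noteq> 1\<close> by simp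
    have "cis (2 * pi * real 1 / real d) \<noteq> cis (2 * pi * real 0 / real d)"
      using Complex.bij_betw_roots_unity[of d] \<open>d \<ge> 2\<close>
      by (intro inj_on_contraD[of "\<lambda>k. cis (2 * pi * real k / real d)" "{..<d}"]) (auto simp: bij_betw_def)
    then show ?thesis using False by (simp add: z_def)
  qed (simp add: z_def)
  moreover have "z powi k = 1" if k: "x [^] k \<in> H" for k :: int
  proof -
    obtain j where j: "k = int d * j" using d[of k] k by auto
    have "cis (2 * pi / d) ^ d = 1" if "d \<noteq> 0" using that by (subst Complex.DeMoivre) simp
    then show ?thesis by (simp add: j z_def power_int_mult)
  qed
  moreover have "norm z = 1" by (simp add: z_def)
  ultimately show thesis using character_trivial_on_subgroup[OF H x(1)] that by metis
qed

end

subsection \<open>Duality between a discrete group and its characters\<close>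

text \<open>No topology enters: for \<open>N = U J\<close> with \<open>J\<close> countable,
  continuity on \<open>\<Pi>\<close> is automatic, and \<open>N = {}\<close> gives all characters of
  the discrete group \<open>G\<close>.\<close>

definition annihilator :: "('a, 'b) monoid_scheme \<Rightarrow> 'a set \<Rightarrow> ('a \<Rightarrow> complex) set" where
  "annihilator G N = {f \<in> extensional (carrier G). f \<in> hom G circle_group \<and> (\<forall>h\<in>N. f h = 1)}"

context group begin

lemma circle_hom_mult:
  "f \<in> hom G circle_group \<Longrightarrow> x \<in> carrier G \<Longrightarrow> y \<in> carrier G \<Longrightarrow> f (x \<otimes> y) = f x * f y"
  using hom_mult[of f G circle_group x y] by simp

lemma circle_hom_norm: "f \<in> hom G circle_group \<Longrightarrow> x \<in> carrier G \<Longrightarrow> norm (f x) = 1"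
  using hom_in_carrier[of f G circle_group x] by simp

lemma circle_hom_nonzero: "f \<in> hom G circle_group \<Longrightarrow> x \<in> carrier G \<Longrightarrow> f x \<noteq> 0"
  using circle_hom_norm[of f x] by auto

lemma circle_hom_one: "f \<in> hom G circle_group \<Longrightarrow> f \<one> = 1"
  using hom_one[OF _ is_group comm_group.axioms(2)[OF comm_group_circle]] by simp

lemma circle_hom_inv:
  assumes "f \<in> hom G circle_group" "x \<in> carrier G"
  shows "f (inv x) = inverse (f x)"
proof -
  have "f (inv x) * f x = 1"
    using circle_hom_mult[OF assms(1), of "inv x" x] assms circle_hom_one[OF assms(1)] by simp
  then show ?thesis by (metis inverse_unique mult.commute)
qed

lemma circle_hom_nat_pow:
  assumes "f \<in> hom G circle_group" "x \<in> carrier G"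
  shows "f (x [^] (n::nat)) = f x ^ n"
  by (induction n) (simp_all add: circle_hom_one circle_hom_mult assms mult.commute)

lemma circle_hom_int_pow:
  assumes "f \<in> hom G circle_group" "x \<in> carrier G"
  shows "f (x [^] (k::int)) = f x powi k"
proof (cases k rule: int_cases2)
  case (nonneg n)
  then show ?thesis by (simp add: int_pow_int circle_hom_nat_pow assms)
next
  case (nonpos n)
  then show ?thesis
    using assms by (simp add: int_pow_neg_int circle_hom_inv circle_hom_nat_pow power_int_minus)
qed

lemma circle_homI:
  assumes "\<And>x. x \<in> carrier G \<Longrightarrow> norm (f x) = 1"
    and "\<And>x y. x \<in> carrier G \<Longrightarrow> y \<in> carrier G \<Longrightarrow> f (x \<otimes> y) = f x * f y"
  shows "f \<in> hom G circle_group"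
  using assms by (auto intro!: homI)

lemma annihilatorD:
  assumes "f \<in> annihilator G N"
  shows "f \<in> hom G circle_group" "h \<in> N \<Longrightarrow> f h = 1" "f \<in> extensional (carrier G)"
  using assms by (auto simp: annihilator_def)

lemma annihilator_mult:
  assumes "f \<in> annihilator G N" "g \<in> annihilator G N" "N \<subseteq> carrier G"
  shows "(\<lambda>x\<in>carrier G. f x * g x) \<in> annihilator G N"
proof -
  have "(\<lambda>x\<in>carrier G. f x * g x) \<in> hom G circle_group"
    using assms annihilatorD(1)
    by (intro circle_homI) (auto simp: circle_hom_norm circle_hom_mult norm_mult)
  then show ?thesis using assms by (auto simp: annihilator_def subset_iff)
qed

lemma annihilator_inverse:
  assumes "f \<in> annihilator G N" "N \<subseteq> carrier G"
  shows "(\<lambda>x\<in>carrier G. inverse (f x)) \<in> annihilator G N"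
proof -
  have "(\<lambda>x\<in>carrier G. inverse (f x)) \<in> hom G circle_group"
    using assms annihilatorD(1)
    by (intro circle_homI) (auto simp: circle_hom_norm circle_hom_mult norm_inverse)
  then show ?thesis using assms by (auto simp: annihilator_def subset_iff)
qed

lemma annihilator_power:
  assumes "f \<in> annihilator G N" "N \<subseteq> carrier G"
  shows "(\<lambda>x\<in>carrier G. f x ^ n) \<in> annihilator G N"
proof -
  have "(\<lambda>x\<in>carrier G. f x ^ n) \<in> hom G circle_group"
    using annihilatorD(1)[OF assms(1)]
    by (intro circle_homI) (auto simp: circle_hom_norm circle_hom_mult norm_power power_mult_distrib)
  then show ?thesis using assms by (auto simp: annihilator_def subset_iff)
qed

lemma annihilator_one:
  assumes "N \<subseteq> carrier G"
  shows "(\<lambda>x\<in>carrier G. 1) \<in> annihilator G N"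
proof -
  have "(\<lambda>x\<in>carrier G. 1) \<in> hom G circle_group" by (intro circle_homI) auto
  then show ?thesis using assms by (auto simp: annihilator_def subset_iff)
qed

end

section \<open>Compactness of annihilators\<close>

lemma closedin_zero_set:
  fixes g :: "'b \<Rightarrow> 'a \<Rightarrow> complex"
  assumes "\<And>p. p \<in> S \<Longrightarrow> continuous_map X euclidean (g p)"
  shows "closedin X {f \<in> topspace X. \<forall>p\<in>S. g p f = 0}"
  unfolding closedin_def
proof (intro conjI)
  have "openin X {f \<in> topspace X. g p f \<in> - {0}}" if "p \<in> S" for p
    by (rule openin_continuous_map_preimage[OF assms[OF that]]) (simp add: open_Compl flip: open_openin)
  then have "openin X (\<Union>p\<in>S. {f \<in> topspace X. g p f \<in> - {0}})" by blast
  also have "(\<Union>p\<in>S. {f \<in> topspace X. g p f \<in> - {0}}) =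
      topspace X - {f \<in> topspace X. \<forall>p\<in>S. g p f = 0}" by auto
  finally show "openin X (topspace X - {f \<in> topspace X. \<forall>p\<in>S. g p f = 0})" .
qed auto

text \<open>Multiplicativity and triviality on \<open>N\<close> are equations between finitely many
  coordinates, so the annihilator is closed in a power of the circle, which is compact by
  Tychonoff's theorem.\<close>

lemma (in group) compactin_annihilator:
  assumes N: "N \<subseteq> carrier G"
  shows "compactin (product_topology (\<lambda>_. top_of_set (sphere 0 1)) (carrier G)) (annihilator G N)"
proof -
  define P where "P = product_topology (\<lambda>_. top_of_set (sphere (0::complex) 1)) (carrier G)"
  have P: "compact_space P"
    unfolding P_def by (simp add: compact_space_product_topology compact_space_subtopology)
  have top: "topspace P = carrier G \<rightarrow>\<^sub>E sphere 0 1" by (simp add: P_def)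
  have coord: "continuous_map P euclidean (\<lambda>f. f x)" if "x \<in> carrier G" for x
    using continuous_map_product_projection[OF that, of "\<lambda>_. top_of_set (sphere (0::complex) 1)"]
    by (simp add: P_def continuous_map_in_subtopology)
  define g where "g = (\<lambda>(x, y) f. f (x \<otimes> y) - f x * f y :: complex)"
  have "continuous_map P euclidean (g p)" if "p \<in> carrier G \<times> carrier G" for p
    using that coord by (auto simp: g_def continuous_map_atin intro!: tendsto_diff tendsto_mult)
  then have 1: "closedin P {f \<in> topspace P. \<forall>p\<in>carrier G \<times> carrier G. g p f = 0}"
    by (rule closedin_zero_set)
  have "continuous_map P euclidean (\<lambda>f. f h - 1)" if "h \<in> N" for h
    using that coord[of h] N by (auto simp: continuous_map_atin intro!: tendsto_diff)
  then have 2: "closedin P {f \<in> topspace P. \<forall>h\<in>N. f h - 1 = 0}"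
    by (rule closedin_zero_set)
  have "annihilator G N = {f \<in> topspace P. \<forall>p\<in>carrier G \<times> carrier G. g p f = 0}
      \<inter> {f \<in> topspace P. \<forall>h\<in>N. f h - 1 = 0}"
    by (auto simp: annihilator_def top g_def PiE_def hom_def)
  then have "closedin P (annihilator G N)" using 1 2 by (simp add: closedin_Int)
  then show ?thesis unfolding P_def[symmetric] using P by (simp add: closedin_compact_space)
qed

text \<open>\<open>\<Phi>\<close> is a character in the algebraic sense. Its continuity is a
  separate hypothesis of the lemmas below, because the induction changes the finite set of points
  that controls it.\<close>

locale annihilator_character = comm_group G for G (structure) +
  fixes N :: "'a set" and \<Phi> :: "('a \<Rightarrow> complex) \<Rightarrow> complex"
  assumes N: "subgroup N G"
    and \<Phi>_norm: "f \<in> annihilator G N \<Longrightarrow> norm (\<Phi> f) = 1"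
    and \<Phi>_mult: "f \<in> annihilator G N \<Longrightarrow> g \<in> annihilator G N \<Longrightarrow>
      \<Phi> (\<lambda>x\<in>carrier G. f x * g x) = \<Phi> f * \<Phi> g"
begin

lemma N_subset: "N \<subseteq> carrier G" using N by (rule subgroup.subset)

lemma \<Phi>_nonzero: "f \<in> annihilator G N \<Longrightarrow> \<Phi> f \<noteq> 0"
  using \<Phi>_norm[of f] by auto

lemma \<Phi>_one: "\<Phi> (\<lambda>x\<in>carrier G. 1) = 1"
proof -
  have "(\<lambda>x\<in>carrier G. (\<lambda>x\<in>carrier G. 1) x * (\<lambda>x\<in>carrier G. 1) x) = (\<lambda>x\<in>carrier G. 1::complex)"
    by (auto simp: fun_eq_iff)
  then show ?thesis
    using \<Phi>_mult[OF annihilator_one annihilator_one] \<Phi>_nonzero[OF annihilator_one] N_subset by simp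
qed

lemma \<Phi>_inverse:
  assumes "f \<in> annihilator G N"
  shows "\<Phi> (\<lambda>x\<in>carrier G. inverse (f x)) = inverse (\<Phi> f)"
proof -
  have "(\<lambda>x\<in>carrier G. f x * (\<lambda>x\<in>carrier G. inverse (f x)) x) = (\<lambda>x\<in>carrier G. 1)"
    using circle_hom_nonzero annihilatorD(1)[OF assms] by (auto simp: fun_eq_iff)
  then have "\<Phi> f * \<Phi> (\<lambda>x\<in>carrier G. inverse (f x)) = 1"
    using \<Phi>_mult[OF assms annihilator_inverse[OF assms N_subset]] \<Phi>_one by simp
  then show ?thesis by (metis inverse_unique)
qed

lemma \<Phi>_power:
  assumes "f \<in> annihilator G N"
  shows "\<Phi> (\<lambda>x\<in>carrier G. f x ^ n) = \<Phi> f ^ n"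
proof (induction n)
  case 0
  have "(\<lambda>x\<in>carrier G. f x ^ 0) = (\<lambda>x\<in>carrier G. 1)" by simp
  then show ?case using \<Phi>_one by (simp only: power_0)
next
  case (Suc n)
  define g where "g = (\<lambda>x\<in>carrier G. f x ^ n)"
  have "(\<lambda>x\<in>carrier G. f x ^ Suc n) = (\<lambda>x\<in>carrier G. f x * g x)"
    by (auto simp: fun_eq_iff g_def)
  moreover have "g \<in> annihilator G N" unfolding g_def by (rule annihilator_power[OF assms N_subset])
  moreover have "\<Phi> g = \<Phi> f ^ n" using Suc by (simp only: g_def)
  ultimately show ?case using \<Phi>_mult[OF assms, of g] by (simp only: power_Suc)
qed

text \<open>A finite set witnessing continuity at the identity for the single radius \<open>1\<close> witnesses it
  for every radius, since the circle has no small subgroups.\<close>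

lemma \<Phi>_uniform_nbhd:
  assumes F: "F \<subseteq> carrier G" and "e > 0" "\<eta> > 0"
    and small: "\<And>f. f \<in> annihilator G N \<Longrightarrow> \<forall>y\<in>F. norm (f y - 1) < e \<Longrightarrow> norm (\<Phi> f - 1) < 1"
  shows "\<exists>d>0. \<forall>f\<in>annihilator G N. (\<forall>y\<in>F. norm (f y - 1) < d) \<longrightarrow> norm (\<Phi> f - 1) < \<eta>"
proof -
  \<comment> \<open>After \<open>m\<close> squarings a distance of at least \<open>\<eta>\<close>
    from 1 would have grown past 1. The radius \<open>e / 2 ^ m\<close> keeps all these powers of
    \<open>f\<close> within \<open>e\<close> of 1 on \<open>F\<close>.\<close>
  obtain m :: nat where m: "1 / \<eta> < (3/2) ^ m" using real_arch_pow[of "3/2::real"] by auto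
  have "norm (\<Phi> f - 1) < \<eta>"
    if f: "f \<in> annihilator G N" and fF: "\<forall>y\<in>F. norm (f y - 1) < e / 2 ^ m" for f
  proof -
    have pow: "norm (\<Phi> f ^ 2 ^ i - 1) < 1" if "i \<le> m" for i
    proof -
      have "norm (f y ^ 2 ^ i - 1) < e" if y: "y \<in> F" for y
      proof -
        have n: "norm (f y) = 1" using circle_hom_norm[OF annihilatorD(1)[OF f]] y F by auto
        have "norm (f y ^ k - 1) \<le> real k * norm (f y - 1)" for k
        proof (induction k)
          case (Suc k)
          then show ?case using norm_mult_minus_one_le[OF n, of "f y ^ k"] by (simp add: algebra_simps)
        qed simp
        from this[of "2 ^ i"] have "norm (f y ^ 2 ^ i - 1) \<le> 2 ^ i * norm (f y - 1)" by simp
        also have "\<dots> \<le> 2 ^ m * norm (f y - 1)" using \<open>i \<le> m\<close> by (intro mult_right_mono) auto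
        also have "\<dots> < e" using fF y by (simp add: field_simps)
        finally show ?thesis .
      qed
      then have "\<forall>y\<in>F. norm ((\<lambda>x\<in>carrier G. f x ^ 2 ^ i) y - 1) < e" using F by (auto simp: subset_iff)
      then show ?thesis
        using small[of "\<lambda>x\<in>carrier G. f x ^ 2 ^ i"] annihilator_power[OF f N_subset, of "2 ^ i"] \<Phi>_power[OF f, of "2 ^ i"] by simp
    qed
    have "(3/2) ^ m * norm (\<Phi> f - 1) \<le> norm (\<Phi> f ^ 2 ^ m - 1)"
      using pow by (intro norm_power_minus_one_ge \<Phi>_norm f) auto
    then have "(3/2) ^ m * norm (\<Phi> f - 1) < 1" using pow[of m] by simp
    also have "1 < (3/2) ^ m * \<eta>" using m \<open>\<eta> > 0\<close> by (simp add: divide_less_eq)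
    finally show ?thesis by simp
  qed
  then show ?thesis using \<open>e > 0\<close> by (intro exI[of _ "e / 2 ^ m"]) simp
qed

end

text \<open>The radius depends on a word for \<open>h\<close>: factors from \<open>N\<close> cost
  nothing, inversion preserves the distance to 1, and a product at most adds distances.\<close>

lemma (in group) annihilator_small_on_generate:
  assumes N: "N \<subseteq> carrier G" and F: "F \<subseteq> carrier G" and h: "h \<in> generate G (F \<union> N)" and "d > 0"
  shows "\<exists>e>0. \<forall>f\<in>annihilator G N. (\<forall>y\<in>F. norm (f y - 1) < e) \<longrightarrow> norm (f h - 1) < d"
  using h \<open>d > 0\<close>
proof (induction arbitrary: d rule: generate.induct)
  case one
  then show ?case by (intro exI[of _ 1]) (simp add: circle_hom_one[OF annihilatorD(1)])
next
  case (incl h)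
  then show ?case by (intro exI[of _ d]) (auto simp: annihilatorD(2))
next
  case (inv h)
  then have "h \<in> carrier G" using N F by auto
  then show ?case using inv
    by (intro exI[of _ d]) (auto simp: annihilatorD(2) circle_hom_inv[OF annihilatorD(1)]
      norm_inverse_minus_one[OF circle_hom_norm[OF annihilatorD(1)]])
next
  case (eng h1 h2)
  have car: "h1 \<in> carrier G" "h2 \<in> carrier G" using eng generate_in_carrier[of "F \<union> N"] N F by auto
  obtain e1 where e1: "e1 > 0" "\<And>f. f \<in> annihilator G N \<Longrightarrow> (\<forall>y\<in>F. norm (f y - 1) < e1) \<Longrightarrow> norm (f h1 - 1) < d / 2"
    using eng.IH(1)[of "d/2"] eng.prems by auto
  obtain e2 where e2: "e2 > 0" "\<And>f. f \<in> annihilator G N \<Longrightarrow> (\<forall>y\<in>F. norm (f y - 1) < e2) \<Longrightarrow> norm (f h2 - 1) < d / 2"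
    using eng.IH(2)[of "d/2"] eng.prems by auto
  show ?case
  proof (intro exI[of _ "min e1 e2"] conjI ballI impI)
    fix f assume f: "f \<in> annihilator G N" "\<forall>y\<in>F. norm (f y - 1) < min e1 e2"
    have "norm (f h1 - 1) < d / 2" "norm (f h2 - 1) < d / 2" using f e1(2) e2(2) by auto
    moreover have "f (h1 \<otimes> h2) = f h1 * f h2" "norm (f h1) = 1"
      using circle_hom_mult circle_hom_norm annihilatorD(1)[OF f(1)] car by auto
    ultimately show "norm (f (h1 \<otimes> h2) - 1) < d"
      using norm_mult_minus_one_le[of "f h1" "f h2"] by simp
  qed (use e1 e2 in auto)
qed

text \<open>Let \<open>K\<close> consist of the members trivial on \<open>F\<close>. Continuity
  makes \<open>\<Phi> f\<close> on \<open>K\<close> a function of \<open>f x\<close> alone, hence a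
  power of \<open>f x\<close>. Divided by that power, the character is trivial on \<open>K\<close>,
  and then smallness on \<open>F\<close> controls it: up to a factor from \<open>K\<close>, an
  \<open>f\<close> that is close to 1 on \<open>F\<close> is close to 1 at \<open>x\<close>
  too.\<close>

lemma annihilator_character_step:
  fixes G (structure)
  assumes "annihilator_character G N \<Phi>" and F: "F \<subseteq> carrier G" and x: "x \<in> carrier G"
    and cont: "\<And>\<eta>. \<eta> > 0 \<Longrightarrow> \<exists>e>0. \<forall>f\<in>annihilator G N.
      (\<forall>y\<in>insert x F. norm (f y - 1) < e) \<longrightarrow> norm (\<Phi> f - 1) < (\<eta>::real)"
  shows "\<exists>k::int. annihilator_character G N (\<lambda>f. \<Phi> f * f x powi (- k)) \<and>
    (\<forall>\<eta>>0. \<exists>e>0. \<forall>f\<in>annihilator G N.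
      (\<forall>y\<in>F. norm (f y - 1) < e) \<longrightarrow> norm (\<Phi> f * f x powi (- k) - 1) < \<eta>)"
proof -
  interpret annihilator_character G N \<Phi> by fact
  define A where "A = annihilator G N"
  note homA = annihilatorD(1)[of _ N, folded A_def]
  note A_mult = annihilator_mult[OF _ _ N_subset, folded A_def]
  note A_inv = annihilator_inverse[OF _ N_subset, folded A_def]
  define K where "K = {f \<in> A. \<forall>y\<in>F. f y = 1}"
  define H where "H = generate G (F \<union> N)"
  have H: "subgroup H G" unfolding H_def using F N_subset by (intro generate_is_subgroup) auto
  obtain d where d: "\<And>k::int. x [^] k \<in> H \<longleftrightarrow> int d dvd k"
    using subgroup_int_pow_multiples[OF is_group H x] by blast
  \<comment> \<open>A member of \<open>K\<close> is small on \<open>F\<close> for every radius, so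
    no further induction over words is needed.\<close>
  have K_H: "f h = 1" if "f \<in> K" "h \<in> H" for f h
  proof -
    have "norm (f h - 1) < e" if "e > 0" for e
      using annihilator_small_on_generate[OF N_subset F, of h e] \<open>f \<in> K\<close> \<open>h \<in> H\<close> \<open>e > 0\<close>
      by (auto simp: H_def K_def A_def)
    from this[of "norm (f h - 1)"] show ?thesis by auto
  qed
  have K_pow: "f x ^ d = 1" if "f \<in> K" for f
  proof -
    have "x [^] int d \<in> H" using d by simp
    from K_H[OF that this] show ?thesis
      using circle_hom_int_pow[OF homA x, of f "int d"] that by (simp add: K_def)
  qed
  \<comment> \<open>For \<open>d = 0\<close> the condition \<open>z ^ d = 1\<close> is vacuous and
    the whole circle is attained.\<close>
  have attain: "\<exists>f\<in>K. f x = z" if z: "norm z = 1" "z ^ d = 1" for z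
  proof -
    have "z powi k = 1" if k: "x [^] k \<in> H" for k :: int
    proof -
      obtain j where "k = int d * j" using d[of k] k by auto
      then show ?thesis using z(2) by (simp add: power_int_mult)
    qed
    then obtain f where f: "f \<in> hom G circle_group" "\<And>h. h \<in> H \<Longrightarrow> f h = 1" "f x = z"
      using character_trivial_on_subgroup[OF H x z(1)] by metis
    have "restrict f (carrier G) \<in> hom G circle_group"
      using f(1) by (intro circle_homI) (auto simp: circle_hom_norm circle_hom_mult)
    moreover have "F \<union> N \<subseteq> H" unfolding H_def by (auto intro: generate.incl)
    ultimately have "restrict f (carrier G) \<in> K"
      using f F N_subset by (auto simp: K_def A_def annihilator_def subset_iff)
    then show ?thesis using f(3) x by (intro bexI[of _ "restrict f (carrier G)"]) auto
  qed
  \<comment> \<open>Every power of \<open>f\<close> equals 1 on \<open>insert x F\<close>, so it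
    passes the continuity test whatever the radius is.\<close>
  have trivial: "\<Phi> f = 1" if f: "f \<in> K" "f x = 1" for f
  proof (rule unit_eq_one_if_powers_near_one)
    show "norm (\<Phi> f) = 1" using f \<Phi>_norm by (auto simp: K_def A_def)
    fix n :: nat
    have fA: "f \<in> annihilator G N" using f by (auto simp: K_def A_def)
    obtain e where e: "e > 0" "\<And>f. f \<in> annihilator G N \<Longrightarrow> \<forall>y\<in>insert x F. norm (f y - 1) < e \<Longrightarrow> norm (\<Phi> f - 1) < 1"
      using cont[of 1] by auto
    have "\<forall>y\<in>insert x F. norm ((\<lambda>x\<in>carrier G. f x ^ n) y - 1) < e"
      using f x F e(1) by (auto simp: K_def subset_iff)
    then show "norm (\<Phi> f ^ n - 1) < 1"
      using e(2)[of "\<lambda>x\<in>carrier G. f x ^ n"] annihilator_power[OF fA N_subset, of n] \<Phi>_power[OF fA, of n] by simp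
  qed
  have determined: "\<Phi> f = \<Phi> g" if fg: "f \<in> K" "g \<in> K" "f x = g x" for f g
  proof -
    let ?i = "\<lambda>y\<in>carrier G. inverse (g y)"
    let ?q = "\<lambda>y\<in>carrier G. f y * ?i y"
    have A: "f \<in> A" "g \<in> A" using fg by (auto simp: K_def)
    have "?q \<in> K" using fg A_mult[OF A(1) A_inv[OF A(2)]] F by (auto simp: K_def subset_iff)
    moreover have "?q x = 1" using fg x circle_hom_nonzero[OF homA[OF A(2)] x] by simp
    ultimately have "\<Phi> ?q = 1" by (rule trivial)
    moreover have "\<Phi> ?q = \<Phi> f * inverse (\<Phi> g)"
      using \<Phi>_mult[of f ?i] \<Phi>_inverse[of g] A A_inv[OF A(2)] unfolding A_def by (simp only:)
    ultimately show ?thesis using \<Phi>_nonzero[of g] A(2) by (simp add: A_def field_simps)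
  qed
  have "\<exists>k::int. \<forall>f\<in>K. \<Phi> f = f x powi k"
  proof (cases "d = 0")
    case True
    \<comment> \<open>Infinite order: the values \<open>f x\<close> fill the circle, and
      \<open>\<Phi>\<close> descends to a continuous endomorphism \<open>\<psi>\<close> of
      it.\<close>
    define \<kappa> where "\<kappa> z = (SOME f. f \<in> K \<and> f x = z)" for z
    have \<kappa>: "\<kappa> z \<in> K" "\<kappa> z x = z" if "norm z = 1" for z
    proof -
      have "\<exists>f. f \<in> K \<and> f x = z" using attain[OF that] True by auto
      from someI_ex[OF this] show "\<kappa> z \<in> K" "\<kappa> z x = z" unfolding \<kappa>_def by blast+
    qed
    define \<psi> where "\<psi> z = \<Phi> (\<kappa> z)" for z
    have \<psi>_norm: "norm (\<psi> z) = 1" if "norm z = 1" for z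
      using \<kappa>[OF that] \<Phi>_norm by (auto simp: \<psi>_def K_def A_def)
    have \<psi>_mult: "\<psi> (z * w) = \<psi> z * \<psi> w" if zw: "norm z = 1" "norm w = 1" for z w
    proof -
      let ?p = "\<lambda>y\<in>carrier G. \<kappa> z y * \<kappa> w y"
      have "\<kappa> z \<in> A" "\<kappa> w \<in> A" using \<kappa> zw by (auto simp: K_def)
      then have "?p \<in> K" "\<Phi> ?p = \<psi> z * \<psi> w"
        using \<kappa>(1)[OF zw(1)] \<kappa>(1)[OF zw(2)] A_mult F \<Phi>_mult by (auto simp: K_def A_def subset_iff \<psi>_def)
      moreover have "?p x = z * w" using x \<kappa> zw by simp
      ultimately show ?thesis
        using determined[of "\<kappa> (z * w)" ?p] \<kappa>[of "z * w"] zw by (simp add: \<psi>_def norm_mult)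
    qed
    have "continuous_on (sphere 0 1) \<psi>"
      unfolding continuous_on_iff
    proof (intro ballI allI impI)
      fix z \<epsilon> assume z: "z \<in> sphere (0::complex) 1" and "\<epsilon> > (0::real)"
      obtain e where e: "e > 0" "\<And>f. f \<in> A \<Longrightarrow> \<forall>y\<in>insert x F. norm (f y - 1) < e \<Longrightarrow> norm (\<Phi> f - 1) < \<epsilon>"
        using cont[OF \<open>\<epsilon> > 0\<close>] unfolding A_def by blast
      show "\<exists>d>0. \<forall>w\<in>sphere 0 1. dist w z < d \<longrightarrow> dist (\<psi> w) (\<psi> z) < \<epsilon>"
      proof (intro exI[of _ e] conjI ballI impI)
        fix w assume w: "w \<in> sphere (0::complex) 1" "dist w z < e"
        have n: "norm (w / z) = 1" using z w by (simp add: norm_divide)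
        have z0: "z \<noteq> 0" using z by auto
        have "norm (w / z - 1) = norm ((w - z) / z)" using z0 by (simp add: diff_divide_distrib)
        then have "norm (w / z - 1) < e" using w z by (simp add: norm_divide dist_norm)
        \<comment> \<open>\<open>\<kappa> (w / z)\<close> is 1 on \<open>F\<close> and close to 1 at
          \<open>x\<close>, so continuity of \<open>\<Phi>\<close> at the identity gives continuity
          of \<open>\<psi>\<close> at \<open>z\<close>.\<close>
        then have "norm (\<psi> (w / z) - 1) < \<epsilon>"
          unfolding \<psi>_def using \<kappa>[OF n] e(1) by (intro e(2)) (auto simp: K_def)
        moreover have "\<psi> w = \<psi> (w / z) * \<psi> z" using \<psi>_mult[of "w / z" z] n z z0 by simp
        ultimately show "dist (\<psi> w) (\<psi> z) < \<epsilon>"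
          using \<psi>_norm[of z] z norm_mult[of "\<psi> (w / z) - 1" "\<psi> z"] by (simp add: dist_norm algebra_simps)
      qed (use e in auto)
    qed
    then obtain k where k: "\<And>z. norm z = 1 \<Longrightarrow> \<psi> z = z powi k"
      using circle_endomorphism_eq_power[of \<psi>] \<psi>_norm \<psi>_mult by blast
    have "\<Phi> f = f x powi k" if "f \<in> K" for f
    proof -
      have n: "norm (f x) = 1" using that homA circle_hom_norm x by (auto simp: K_def)
      have "\<Phi> f = \<psi> (f x)" unfolding \<psi>_def using \<kappa>[OF n] that by (intro determined) auto
      then show ?thesis using k n by simp
    qed
    then show ?thesis by blast
  next
    case False
    \<comment> \<open>Finite order: the values \<open>f x\<close> are the powers of
      \<open>\<omega>\<close>, so one \<open>\<kappa>\<close> with value \<open>\<omega>\<close> at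
      \<open>x\<close> decides everything. \<open>\<Phi> \<kappa>\<close> is again a
      \<open>d\<close>-th root of unity, and its exponent is the wanted \<open>k\<close>.\<close>
    define \<omega> where "\<omega> = cis (2 * pi / d)"
    have roots: "\<exists>j. z = \<omega> ^ j" if "z ^ d = 1" for z
    proof -
      have "z \<in> (\<lambda>k. cis (2 * pi * real k / real d)) ` {..<d}"
        using Complex.bij_betw_roots_unity[of d] that False by (auto simp: bij_betw_def)
      then obtain j where "z = cis (2 * pi * real j / real d)" by auto
      then have "z = \<omega> ^ j" unfolding \<omega>_def by (subst Complex.DeMoivre) (simp add: mult_ac)
      then show ?thesis by blast
    qed
    have "\<omega> ^ d = 1" unfolding \<omega>_def using False by (subst Complex.DeMoivre) simp
    moreover have "norm \<omega> = 1" by (simp add: \<omega>_def)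
    ultimately obtain \<kappa> where \<kappa>: "\<kappa> \<in> K" "\<kappa> x = \<omega>" using attain by blast
    have \<kappa>A: "\<kappa> \<in> annihilator G N" using \<kappa> by (simp add: K_def A_def)
    have pow: "(\<lambda>x\<in>carrier G. \<kappa> x ^ n) \<in> K" "\<Phi> (\<lambda>x\<in>carrier G. \<kappa> x ^ n) = \<Phi> \<kappa> ^ n" for n
      using annihilator_power[OF \<kappa>A N_subset, of n] \<Phi>_power[OF \<kappa>A, of n] \<kappa>(1) F by (auto simp: K_def A_def subset_iff)
    have "\<Phi> \<kappa> ^ d = 1"
      using trivial[OF pow(1)[of d]] pow(2)[of d] x \<kappa>(2) \<open>\<omega> ^ d = 1\<close> by simp
    then obtain j where j: "\<Phi> \<kappa> = \<omega> ^ j" using roots by blast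
    have "\<Phi> f = f x powi (int j)" if f: "f \<in> K" for f
    proof -
      obtain i where i: "f x = \<omega> ^ i" using roots K_pow[OF f] by blast
      have "\<Phi> f = \<Phi> \<kappa> ^ i" using determined[OF f pow(1)[of i]] pow(2)[of i] i \<kappa>(2) x by simp
      then show ?thesis by (simp add: i j power_mult[symmetric] mult.commute)
    qed
    then show ?thesis by blast
  qed
  then obtain k where k: "\<And>f. f \<in> K \<Longrightarrow> \<Phi> f = f x powi k" by blast
  define \<Psi> where "\<Psi> f = \<Phi> f * f x powi (- k)" for f
  interpret \<Psi>: annihilator_character G N \<Psi>
  proof
    show "norm (\<Psi> f) = 1" if "f \<in> annihilator G N" for f
      using \<Phi>_norm[OF that] circle_hom_norm[OF annihilatorD(1)[OF that] x]
      by (simp add: \<Psi>_def norm_mult norm_power_int)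
    show "\<Psi> (\<lambda>x\<in>carrier G. f x * g x) = \<Psi> f * \<Psi> g"
      if "f \<in> annihilator G N" "g \<in> annihilator G N" for f g
      using \<Phi>_mult[OF that] x by (simp add: \<Psi>_def power_int_mult_distrib)
  qed (use N in \<open>auto dest: subgroup.subset subgroup.m_closed subgroup.one_closed subgroup.m_inv_closed\<close>)
  have \<Psi>_K: "\<Psi> f = 1" if "f \<in> K" for f
  proof -
    have "f x \<noteq> 0" using that circle_hom_nonzero[OF homA x] by (auto simp: K_def)
    then show ?thesis using k[OF that] by (simp add: \<Psi>_def power_int_minus)
  qed
  have "\<exists>e>0. \<forall>f\<in>A. (\<forall>y\<in>F. norm (f y - 1) < e) \<longrightarrow> norm (\<Psi> f - 1) < \<eta>" if "\<eta> > 0" for \<eta>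
  proof -
    obtain e1 where e1: "e1 > 0"
      "\<And>f. f \<in> A \<Longrightarrow> \<forall>y\<in>insert x F. norm (f y - 1) < e1 \<Longrightarrow> norm (\<Phi> f - 1) < \<eta> / 2"
      using cont[of "\<eta> / 2"] \<open>\<eta> > 0\<close> unfolding A_def by (meson half_gt_zero)
    have "isCont (\<lambda>z::complex. z powi (- k)) 1" by (intro continuous_intros) auto
    then obtain e2 where e2: "e2 > 0" "\<And>z::complex. norm (z - 1) < e2 \<Longrightarrow> norm (z powi (- k) - 1) < \<eta> / 2"
      using \<open>\<eta> > 0\<close> unfolding continuous_at_eps_delta dist_norm
      by (metis half_gt_zero power_int_1_left)
    define e0 where "e0 = min e1 e2"
    have "e0 > 0" using e1 e2 by (simp add: e0_def)
    have small: "norm (\<Psi> f - 1) < \<eta>" if f: "f \<in> A" "\<forall>y\<in>insert x F. norm (f y - 1) < e0" for f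
    proof -
      have "norm (\<Phi> f - 1) < \<eta> / 2" using f e1(2)[of f] by (simp add: e0_def)
      moreover have "norm (f x powi (- k) - 1) < \<eta> / 2" using f(2) e2(2)[of "f x"] by (simp add: e0_def)
      moreover have "norm (\<Phi> f) = 1" using f \<Phi>_norm by (simp add: A_def)
      ultimately show ?thesis
        using norm_mult_minus_one_le[of "\<Phi> f" "f x powi (- k)"] by (simp add: \<Psi>_def)
    qed
    \<comment> \<open>Since \<open>x [^] d\<close> lies in \<open>H\<close>, smallness on
      \<open>F\<close> alone brings \<open>f x ^ d\<close> close to 1, hence \<open>f x\<close>
      close to a \<open>d\<close>-th root of unity. For \<open>d = 0\<close> the value
      \<open>w = f x\<close> itself is admissible.\<close>
    have "\<exists>e>0. \<forall>f\<in>A. (\<forall>y\<in>F. norm (f y - 1) < e) \<longrightarrow> (\<exists>w. norm w = 1 \<and> w ^ d = 1 \<and> norm (f x - w) < e0)"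
    proof (cases "d = 0")
      case True
      then have "norm (f x) = 1 \<and> f x ^ d = 1 \<and> norm (f x - f x) < e0" if "f \<in> A" for f
        using \<open>e0 > 0\<close> circle_hom_norm[OF homA[OF that] x] by simp
      then show ?thesis by (meson zero_less_one)
    next
      case False
      obtain \<delta> where \<delta>: "\<delta> > 0"
        "\<And>z::complex. norm z = 1 \<Longrightarrow> norm (z ^ d - 1) < \<delta> \<Longrightarrow> \<exists>w. w ^ d = 1 \<and> norm (z - w) < e0"
        using near_root_of_unity[of d e0] False \<open>e0 > 0\<close> by blast
      have "x [^] int d \<in> generate G (F \<union> N)" using d[of "int d"] by (simp add: H_def)
      then obtain e where e: "e > 0"
        "\<And>f. f \<in> A \<Longrightarrow> \<forall>y\<in>F. norm (f y - 1) < e \<Longrightarrow> norm (f (x [^] int d) - 1) < \<delta>"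
        using annihilator_small_on_generate[OF N_subset F _ \<delta>(1)] unfolding A_def by blast
      show ?thesis
      proof (intro exI[of _ e] conjI ballI impI)
        fix f assume f: "f \<in> A" "\<forall>y\<in>F. norm (f y - 1) < e"
        have "norm (f x ^ d - 1) < \<delta>"
          using e(2)[OF f] circle_hom_int_pow[OF homA[OF f(1)] x, of "int d"] by simp
        then obtain w where w: "w ^ d = 1" "norm (f x - w) < e0"
          using \<delta>(2) circle_hom_norm[OF homA[OF f(1)] x] by blast
        then show "\<exists>w. norm w = 1 \<and> w ^ d = 1 \<and> norm (f x - w) < e0"
          using power_eq_1_iff[OF w(1)] False by blast
      qed (rule e)
    qed
    then obtain e where e: "e > 0" "\<And>f. f \<in> A \<Longrightarrow> \<forall>y\<in>F. norm (f y - 1) < e \<Longrightarrow>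
      \<exists>w. norm w = 1 \<and> w ^ d = 1 \<and> norm (f x - w) < e0" by blast
    show ?thesis
    proof (intro exI[of _ "min e e0"] conjI ballI impI)
      fix f assume f: "f \<in> A" "\<forall>y\<in>F. norm (f y - 1) < min e e0"
      then obtain w where w: "norm w = 1" "w ^ d = 1" "norm (f x - w) < e0" using e(2)[of f] by auto
      then obtain \<kappa> where \<kappa>: "\<kappa> \<in> K" "\<kappa> x = w" using attain by blast
      then have \<kappa>A: "\<kappa> \<in> A" by (simp add: K_def)
      \<comment> \<open>Dividing \<open>f\<close> by \<open>\<kappa>\<close> leaves
        \<open>\<Psi>\<close> and the values on \<open>F\<close> unchanged and brings the value at
        \<open>x\<close> close to 1.\<close>
      let ?i = "\<lambda>y\<in>carrier G. inverse (\<kappa> y)"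
      let ?q = "\<lambda>y\<in>carrier G. f y * ?i y"
      have iA: "?i \<in> A" by (rule A_inv[OF \<kappa>A])
      have "?i \<in> K" using iA \<kappa> F by (auto simp: K_def subset_iff)
      then have "\<Psi> ?q = \<Psi> f" using \<Psi>.\<Phi>_mult[of f ?i] f(1) iA \<Psi>_K by (simp add: A_def)
      moreover have "norm (\<Psi> ?q - 1) < \<eta>"
      proof (rule small)
        show "?q \<in> A" by (rule A_mult[OF f(1) iA])
        have "w \<noteq> 0" using w by auto
        then have "f x * inverse w - 1 = (f x - w) * inverse w" by (simp add: left_diff_distrib)
        then have "norm (?q x - 1) < e0" using x \<kappa>(2) w by (simp add: norm_mult norm_inverse)
        moreover have "norm (?q y - 1) < e0" if "y \<in> F" for y
        proof -
          have "?q y = f y" using that \<kappa>(1) F by (auto simp: K_def)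
          then show ?thesis using f(2) that by simp
        qed
        ultimately show "\<forall>y\<in>insert x F. norm (?q y - 1) < e0" by blast
      qed
      ultimately show "norm (\<Psi> f - 1) < \<eta>" by simp
    qed (use e \<open>e0 > 0\<close> in auto)
  qed
  then show ?thesis
    using \<Psi>.annihilator_character_axioms unfolding A_def \<Psi>_def by blast
qed

text \<open>Each point of \<open>F\<close> is removed at the price of a power of the evaluation at
  it, and with no points left the continuity condition forces the value 1. The representing point is
  the product of the collected powers.\<close>

lemma annihilator_character_is_evaluation:
  assumes "finite F" "annihilator_character G N \<Phi>" and "F \<subseteq> carrier G"
    and "\<And>\<eta>. \<eta> > 0 \<Longrightarrow> \<exists>e>0. \<forall>f\<in>annihilator G N.
      (\<forall>y\<in>F. norm (f y - 1) < e) \<longrightarrow> norm (\<Phi> f - 1) < (\<eta>::real)"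
  shows "\<exists>x\<in>carrier G. \<forall>f\<in>annihilator G N. \<Phi> f = f x"
  using assms
proof (induction F arbitrary: \<Phi> rule: finite_induct)
  case empty
  interpret annihilator_character G N \<Phi> by fact
  have "\<Phi> f = 1" if f: "f \<in> annihilator G N" for f
  proof -
    have "norm (\<Phi> f - 1) < \<eta>" if "\<eta> > 0" for \<eta> using empty(3)[OF that] f by auto
    from this[of "norm (\<Phi> f - 1)"] show ?thesis by auto
  qed
  then show ?case using circle_hom_one[OF annihilatorD(1)] by (intro bexI[of _ "\<one>\<^bsub>G\<^esub>"]) auto
next
  case (insert x F)
  interpret annihilator_character G N \<Phi> by fact
  have x: "x \<in> carrier G" and F: "F \<subseteq> carrier G" using insert by auto
  obtain k :: int where k: "annihilator_character G N (\<lambda>f. \<Phi> f * f x powi (- k))"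
    "\<forall>\<eta>>0. \<exists>e>0. \<forall>f\<in>annihilator G N.
      (\<forall>y\<in>F. norm (f y - 1) < e) \<longrightarrow> norm (\<Phi> f * f x powi (- k) - 1) < \<eta>"
    using annihilator_character_step[OF insert.prems(1) F x] insert.prems(3) by blast
  obtain a where a: "a \<in> carrier G" "\<And>f. f \<in> annihilator G N \<Longrightarrow> \<Phi> f * f x powi (- k) = f a"
    using insert.IH[OF k(1) F] k(2) by blast
  have "\<Phi> f = f (a \<otimes>\<^bsub>G\<^esub> x [^]\<^bsub>G\<^esub> k)" if f: "f \<in> annihilator G N" for f
  proof -
    have "f x \<noteq> 0" using circle_hom_nonzero annihilatorD(1)[OF f] x by blast
    then have "\<Phi> f = f a * f x powi k" using a(2)[OF f] by (simp add: power_int_minus field_simps)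
    then show ?thesis
      using circle_hom_mult[OF annihilatorD(1)[OF f]] circle_hom_int_pow[OF annihilatorD(1)[OF f] x] a x by simp
  qed
  then show ?case using a(1) x by (intro bexI[of _ "a \<otimes>\<^bsub>G\<^esub> x [^]\<^bsub>G\<^esub> k"]) auto
qed

subsection \<open>Dual groups and reflexivity\<close>

lemma homeomorphic_map_if_open_iff:
  assumes bij: "bij_betw f (topspace X) (topspace Y)"
    and op: "\<And>U. U \<subseteq> topspace X \<Longrightarrow> openin X U \<longleftrightarrow> openin Y (f ` U)"
  shows "homeomorphic_map X Y f"
proof (rule bijective_open_imp_homeomorphic_map)
  show "open_map X Y f" unfolding open_map_def using op openin_subset by blast
  show "f ` topspace X = topspace Y" "inj_on f (topspace X)" using bij by (auto simp: bij_betw_def)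
  show "continuous_map X Y f"
    unfolding continuous_map_def
  proof (intro conjI allI impI)
    show "f \<in> topspace X \<rightarrow> topspace Y" using bij by (auto simp: bij_betw_def)
    fix V assume V: "openin Y V"
    have "f ` {x \<in> topspace X. f x \<in> V} = V"
      using openin_subset[OF V] bij by (auto simp: bij_betw_def)
    then show "openin X {x \<in> topspace X. f x \<in> V}" using op[of "{x \<in> topspace X. f x \<in> V}"] V by auto
  qed
qed

lemma charactersD:
  assumes "f \<in> characters G T"
  shows "f \<in> hom G circle_group" "f \<in> extensional (carrier G)" "continuous_map T euclidean f"
  using assms by (auto simp: characters_def continuous_map_in_subtopology)

lemma charactersI:
  assumes "f \<in> hom G circle_group" "f \<in> extensional (carrier G)" "continuous_map T euclidean f"
    "topspace T = carrier G"
  shows "f \<in> characters G T"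
  using assms by (auto simp: characters_def continuous_map_in_subtopology hom_def)

lemma dual_group_simps [simp]:
  "carrier (dual_group G T) = characters G T"
  "f \<otimes>\<^bsub>dual_group G T\<^esub> g = (\<lambda>x\<in>carrier G. f x * g x)"
  "\<one>\<^bsub>dual_group G T\<^esub> = (\<lambda>x\<in>carrier G. 1)"
  by (simp_all add: dual_group_def)

text \<open>It carries just what the dual construction uses, so that it can be instantiated at once
  for the dual and the bidual.\<close>

locale group_with_topology = group G for G (structure) and T +
  assumes topspace_eq: "topspace T = carrier G"
begin

lemma characters_annihilator: "characters G T = {f \<in> annihilator G {}. continuous_map T euclidean f}"
proof
  show "characters G T \<subseteq> {f \<in> annihilator G {}. continuous_map T euclidean f}"
    by (auto simp: annihilator_def charactersD)
  show "{f \<in> annihilator G {}. continuous_map T euclidean f} \<subseteq> characters G T"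
    unfolding annihilator_def using charactersI[OF _ _ _ topspace_eq] by blast
qed

lemma characters_mult:
  assumes "f \<in> characters G T" "g \<in> characters G T"
  shows "(\<lambda>x\<in>carrier G. f x * g x) \<in> characters G T"
proof -
  have "continuous_map T euclidean (\<lambda>x. f x * g x)"
    using assms by (auto simp: characters_annihilator continuous_map_atin intro!: tendsto_mult)
  then have "continuous_map T euclidean (\<lambda>x\<in>carrier G. f x * g x)"
    by (rule continuous_map_eq) (simp add: topspace_eq)
  then show ?thesis using assms annihilator_mult[of f "{}" g] by (simp add: characters_annihilator)
qed

lemma characters_inverse:
  assumes "f \<in> characters G T"
  shows "(\<lambda>x\<in>carrier G. inverse (f x)) \<in> characters G T"
proof -
  have "continuous_map T euclidean (\<lambda>x. inverse (f x))"
    using charactersD(3)[OF assms] circle_hom_nonzero[OF charactersD(1)[OF assms]]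
    by (auto simp: continuous_map_atin topspace_eq intro!: tendsto_inverse)
  then have "continuous_map T euclidean (\<lambda>x\<in>carrier G. inverse (f x))"
    by (rule continuous_map_eq) (simp add: topspace_eq)
  then show ?thesis using assms annihilator_inverse[of f "{}"] by (simp add: characters_annihilator)
qed

lemma characters_one: "(\<lambda>x\<in>carrier G. 1) \<in> characters G T"
proof -
  have "continuous_map T euclidean (\<lambda>x\<in>carrier G. 1::complex)"
    by (rule continuous_map_eq[of _ _ "\<lambda>_. 1"]) (auto simp: topspace_eq)
  then show ?thesis using annihilator_one[of "{}"] by (simp add: characters_annihilator)
qed

lemma comm_group_dual: "comm_group (dual_group G T)"
proof (rule comm_groupI)
  fix f assume f: "f \<in> carrier (dual_group G T)"
  show "\<exists>g\<in>carrier (dual_group G T). g \<otimes>\<^bsub>dual_group G T\<^esub> f = \<one>\<^bsub>dual_group G T\<^esub>"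
    using f characters_inverse circle_hom_nonzero[OF charactersD(1)]
    by (intro bexI[of _ "\<lambda>x\<in>carrier G. inverse (f x)"]) (auto simp: fun_eq_iff)
  show "\<one>\<^bsub>dual_group G T\<^esub> \<otimes>\<^bsub>dual_group G T\<^esub> f = f"
    using f charactersD(2)[of f G T] by (auto simp: fun_eq_iff extensional_def)
qed (auto simp: characters_mult characters_one mult_ac fun_eq_iff)

lemma inv_dual:
  assumes "f \<in> characters G T"
  shows "inv\<^bsub>dual_group G T\<^esub> f = (\<lambda>x\<in>carrier G. inverse (f x))"
proof -
  interpret dual: comm_group "dual_group G T" by (rule comm_group_dual)
  show ?thesis
    using assms characters_inverse[OF assms] circle_hom_nonzero[OF charactersD(1)[OF assms]]
    by (intro dual.inv_equality) (auto simp: fun_eq_iff)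
qed

text \<open>On the compact set \<open>K\<close> the distance between \<open>g\<close> and
  \<open>f\<close> attains its maximum, which is below \<open>e\<close>; the remaining margin serves
  as a radius around \<open>g\<close>.\<close>

lemma dual_nbhd_open:
  assumes "compactin T K" "f \<in> characters G T"
  shows "openin (dual_topology G T) {g \<in> characters G T. \<forall>x\<in>K. dist (g x) (f x) < e}"
  unfolding openin_dual_topology
proof (intro conjI ballI)
  fix g assume g: "g \<in> {g \<in> characters G T. \<forall>x\<in>K. dist (g x) (f x) < e}"
  have "\<exists>d>0. \<forall>x\<in>K. dist (g x) (f x) \<le> e - d"
  proof (cases "K = {}")
    case False
    have "continuous_map T euclideanreal (\<lambda>x. dist (g x) (f x))"
      using charactersD(3)[of g] charactersD(3)[OF assms(2)] g
      by (auto simp: continuous_map_atin intro!: tendsto_dist)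
    then have "compact ((\<lambda>x. dist (g x) (f x)) ` K)"
      using image_compactin[OF assms(1)] by fastforce
    then obtain y where y: "y \<in> K" "\<And>x. x \<in> K \<Longrightarrow> dist (g x) (f x) \<le> dist (g y) (f y)"
      using compact_attains_sup[of "(\<lambda>x. dist (g x) (f x)) ` K"] False by auto
    then show ?thesis using g by (intro exI[of _ "e - dist (g y) (f y)"]) auto
  qed (auto intro: exI[of _ 1])
  then obtain d where d: "d > 0" "\<And>x. x \<in> K \<Longrightarrow> dist (g x) (f x) \<le> e - d" by auto
  have "dist (h x) (f x) < e" if "x \<in> K" "dist (h x) (g x) < d" for h x
    using d(2)[OF that(1)] that(2) dist_triangle[of "h x" "f x" "g x"] by linarith
  then show "\<exists>K' d. compactin T K' \<and> d > 0 \<and> {h \<in> characters G T. \<forall>x\<in>K'. dist (h x) (g x) < d}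
      \<subseteq> {g \<in> characters G T. \<forall>x\<in>K. dist (g x) (f x) < e}"
    using assms(1) d(1) by (intro exI[of _ K] exI[of _ d]) auto
qed auto

lemma continuous_map_into_dual:
  assumes "\<And>x. x \<in> topspace X \<Longrightarrow> h x \<in> characters G T"
    and "\<And>x K e. x \<in> topspace X \<Longrightarrow> compactin T K \<Longrightarrow> e > 0 \<Longrightarrow>
      \<exists>U. openin X U \<and> x \<in> U \<and> (\<forall>y\<in>U. \<forall>k\<in>K. dist (h y k) (h x k) < e)"
  shows "continuous_map X (dual_topology G T) h"
  unfolding continuous_map_def
proof (intro conjI allI impI)
  show "h \<in> topspace X \<rightarrow> topspace (dual_topology G T)" using assms(1) by auto
  fix V assume V: "openin (dual_topology G T) V"
  show "openin X {x \<in> topspace X. h x \<in> V}"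
  proof (subst openin_subopen, intro ballI)
    fix x assume x: "x \<in> {x \<in> topspace X. h x \<in> V}"
    then obtain K e where K: "compactin T K" "e > 0"
      "{g \<in> characters G T. \<forall>k\<in>K. dist (g k) (h x k) < e} \<subseteq> V"
      using V unfolding openin_dual_topology by blast
    obtain U where "openin X U" "x \<in> U" "\<And>y k. y \<in> U \<Longrightarrow> k \<in> K \<Longrightarrow> dist (h y k) (h x k) < e"
      using assms(2)[OF _ K(1,2), of x] x by blast
    then show "\<exists>U. openin X U \<and> x \<in> U \<and> U \<subseteq> {x \<in> topspace X. h x \<in> V}"
      using K(3) assms(1) openin_subset[of X U] by (intro exI[of _ U]) blast
  qed
qed

text \<open>Multiplication by a unit number is an isometry, so under products errors add, hence
  \<open>e / 2\<close>, and inversion preserves them.\<close>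

lemma topological_group_dual: "topological_group (dual_group G T) (dual_topology G T)"
  unfolding topological_group_def
proof (intro conjI)
  let ?D = "dual_topology G T"
  interpret dual: comm_group "dual_group G T" by (rule comm_group_dual)
  show "group (dual_group G T)" by (rule dual.is_group)
  show "topspace ?D = carrier (dual_group G T)" by simp
  show "continuous_map (prod_topology ?D ?D) ?D (\<lambda>(f, g). f \<otimes>\<^bsub>dual_group G T\<^esub> g)"
  proof (rule continuous_map_into_dual)
    fix p K and e :: real assume p: "p \<in> topspace (prod_topology ?D ?D)" and K: "compactin T K" "e > 0"
    obtain f g where fg: "p = (f, g)" "f \<in> characters G T" "g \<in> characters G T" using p by auto
    let ?N = "\<lambda>f. {h \<in> characters G T. \<forall>x\<in>K. dist (h x) (f x) < e / 2}"
    have K_sub: "K \<subseteq> carrier G" using compactin_subset_topspace[OF K(1)] topspace_eq by simp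
    have "dist (f' x * g' x) (f x * g x) < e" if "f' \<in> ?N f" "g' \<in> ?N g" "x \<in> K" for f' g' x
    proof -
      have n: "norm (g' x) = 1" "norm (f x) = 1"
        using that fg K_sub circle_hom_norm[OF charactersD(1)] by auto
      have "f' x * g' x - f x * g x = (f' x - f x) * g' x + f x * (g' x - g x)"
        by (simp add: algebra_simps)
      then have "norm (f' x * g' x - f x * g x) \<le> norm (f' x - f x) + norm (g' x - g x)"
        using norm_triangle_ineq[of "(f' x - f x) * g' x" "f x * (g' x - g x)"] n by (simp add: norm_mult)
      moreover have "norm (f' x - f x) < e / 2" "norm (g' x - g x) < e / 2"
        using that by (auto simp: dist_norm)
      ultimately show ?thesis by (simp add: dist_norm)
    qed
    moreover have "openin (prod_topology ?D ?D) (?N f \<times> ?N g)"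
      unfolding openin_prod_Times_iff using dual_nbhd_open[OF K(1)] fg(2,3) by blast
    moreover have "p \<in> ?N f \<times> ?N g" using fg K(2) by simp
    moreover have "x \<in> carrier G" if "x \<in> K" for x using that K_sub by blast
    ultimately show "\<exists>U. openin (prod_topology ?D ?D) U \<and> p \<in> U \<and>
      (\<forall>q\<in>U. \<forall>k\<in>K. dist ((case q of (f, g) \<Rightarrow> f \<otimes>\<^bsub>dual_group G T\<^esub> g) k)
        ((case p of (f, g) \<Rightarrow> f \<otimes>\<^bsub>dual_group G T\<^esub> g) k) < e)"
      using fg(1) by (intro exI[of _ "?N f \<times> ?N g"] conjI) auto
  qed (auto simp: characters_mult)
  show "continuous_map ?D ?D (\<lambda>f. inv\<^bsub>dual_group G T\<^esub> f)"
  proof (rule continuous_map_into_dual)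
    fix f K and e :: real assume f: "f \<in> topspace ?D" and K: "compactin T K" "e > 0"
    let ?N = "{h \<in> characters G T. \<forall>x\<in>K. dist (h x) (f x) < e}"
    have K_sub: "K \<subseteq> carrier G" using compactin_subset_topspace[OF K(1)] topspace_eq by simp
    have "dist (inverse (g x)) (inverse (f x)) = dist (g x) (f x)" if "g \<in> ?N" "x \<in> K" for g x
    proof -
      have n: "norm (g x) = 1" "norm (f x) = 1"
        using that f K_sub circle_hom_norm[OF charactersD(1)] by auto
      then have "g x \<noteq> 0" "f x \<noteq> 0" by auto
      then show ?thesis using n
        by (simp add: dist_norm inverse_diff_inverse norm_mult norm_inverse norm_minus_commute)
    qed
    then show "\<exists>U. openin ?D U \<and> f \<in> U \<and>
      (\<forall>g\<in>U. \<forall>k\<in>K. dist ((inv\<^bsub>dual_group G T\<^esub> g) k) ((inv\<^bsub>dual_group G T\<^esub> f) k) < e)"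
      using dual_nbhd_open[OF K(1)] f K(2) K_sub
      by (intro exI[of _ ?N]) (auto simp: inv_dual subset_iff)
  qed (auto simp: inv_dual characters_inverse)
qed

lemma Hausdorff_dual: "Hausdorff_space (dual_topology G T)"
  unfolding Hausdorff_space_def
proof (intro allI impI)
  fix f g assume fg: "f \<in> topspace (dual_topology G T) \<and> g \<in> topspace (dual_topology G T) \<and> f \<noteq> g"
  then have "f \<in> characters G T" "g \<in> characters G T" by auto
  then obtain x where x: "x \<in> carrier G" "f x \<noteq> g x"
    using fg charactersD(2) extensionalityI by metis
  define e where "e = dist (f x) (g x) / 2"
  let ?N = "\<lambda>f. {h \<in> characters G T. \<forall>y\<in>{x}. dist (h y) (f y) < e}"
  have "compactin T {x}" using x(1) topspace_eq by simp
  then have "openin (dual_topology G T) (?N f)" "openin (dual_topology G T) (?N g)"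
    using fg by (intro dual_nbhd_open; simp)+
  moreover have "f \<in> ?N f" "g \<in> ?N g" using fg x(2) by (auto simp: e_def)
  moreover have "disjnt (?N f) (?N g)"
  proof -
    have False if "dist (h x) (f x) < e" "dist (h x) (g x) < e" for h
      using that dist_triangle2[of "f x" "g x" "h x"] by (simp add: e_def dist_commute)
    then show ?thesis by (auto simp: disjnt_def)
  qed
  ultimately show "\<exists>U V. openin (dual_topology G T) U \<and> openin (dual_topology G T) V \<and>
      f \<in> U \<and> g \<in> V \<and> disjnt U V" by blast
qed

lemma group_with_topology_dual: "group_with_topology (dual_group G T) (dual_topology G T)"
proof -
  interpret dual: comm_group "dual_group G T" by (rule comm_group_dual)
  show ?thesis by unfold_locales simp
qed

section \<open>The evaluation homomorphism\<close>

lemma evaluation_apply: "f \<in> characters G T \<Longrightarrow> evaluation_hom G T x f = f x"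
  by (simp add: evaluation_hom_def)

lemma evaluation_character:
  assumes x: "x \<in> carrier G"
  shows "evaluation_hom G T x \<in> characters (dual_group G T) (dual_topology G T)"
proof (rule charactersI)
  interpret dual: comm_group "dual_group G T" by (rule comm_group_dual)
  show "evaluation_hom G T x \<in> hom (dual_group G T) circle_group"
    using x by (intro dual.circle_homI)
      (auto simp: evaluation_hom_def characters_mult circle_hom_norm[OF charactersD(1)])
  show "continuous_map (dual_topology G T) euclidean (evaluation_hom G T x)"
    unfolding continuous_map_def
  proof (intro conjI allI impI)
    fix V assume V: "openin euclidean (V :: complex set)"
    show "openin (dual_topology G T) {f \<in> topspace (dual_topology G T). evaluation_hom G T x f \<in> V}"
      unfolding openin_dual_topology
    proof (intro conjI ballI)
      fix f assume f: "f \<in> {f \<in> topspace (dual_topology G T). evaluation_hom G T x f \<in> V}"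
      then obtain e where "e > 0" "ball (f x) e \<subseteq> V"
        using V by (auto simp: evaluation_apply open_contains_ball open_openin[symmetric])
      then show "\<exists>K e. compactin T K \<and> e > 0 \<and> {g \<in> characters G T. \<forall>x\<in>K. dist (g x) (f x) < e}
          \<subseteq> {f \<in> topspace (dual_topology G T). evaluation_hom G T x f \<in> V}"
        using x topspace_eq
        by (intro exI[of _ "{x}"] exI[of _ e]) (auto simp: evaluation_apply subset_iff dist_commute)
    qed auto
  qed auto
qed (auto simp: evaluation_hom_def)

lemma evaluation_hom_hom: "evaluation_hom G T \<in> hom G (bidual_group G T)"
  unfolding bidual_group_def
proof (rule homI)
  fix x y assume xy: "x \<in> carrier G" "y \<in> carrier G"
  show "evaluation_hom G T (x \<otimes> y) =
      evaluation_hom G T x \<otimes>\<^bsub>dual_group (dual_group G T) (dual_topology G T)\<^esub> evaluation_hom G T y"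
    using xy circle_hom_mult[OF charactersD(1)] by (auto simp: evaluation_hom_def fun_eq_iff)
qed (simp add: evaluation_character)

end

text \<open>The transpose of \<open>\<alpha>\<close> inverts \<open>\<beta>\<close>, since
  \<open>\<beta> f (\<alpha> x) = f x\<close>. As \<open>\<alpha>\<close> is a homeomorphism, the
  compact sets of \<open>T\<close> and of the bidual correspond, and so do the basic neighbourhoods
  in the dual and in the third dual.\<close>

lemma reflexive_dual:
  fixes G (structure)
  assumes "reflexive_group G T"
  shows "reflexive_group (dual_group G T) (dual_topology G T)"
proof -
  define G' where "G' = dual_group G T"
  define T' where "T' = dual_topology G T"
  define G'' where "G'' = dual_group G' T'"
  define T'' where "T'' = dual_topology G' T'"
  define \<alpha> where "\<alpha> = evaluation_hom G T"
  define \<beta> where "\<beta> = evaluation_hom G' T'"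
  have G: "comm_group G" "topological_group G T" "\<alpha> \<in> iso G G''" "homeomorphic_map T T'' \<alpha>"
    using assms unfolding reflexive_group_def bidual_group_def bidual_topology_def
      G''_def T''_def G'_def T'_def \<alpha>_def by auto
  interpret G: group_with_topology G T
    using G(1,2) by (auto simp: group_with_topology_def group_with_topology_axioms_def
      topological_group_def comm_group.axioms)
  interpret G': group_with_topology G' T' unfolding G'_def T'_def by (rule G.group_with_topology_dual)
  interpret G'': group_with_topology G'' T'' unfolding G''_def T''_def by (rule G'.group_with_topology_dual)
  have car: "carrier G' = characters G T" "carrier G'' = characters G' T'" by (simp_all add: G'_def G''_def)
  have \<alpha>_bij: "bij_betw \<alpha> (carrier G) (characters G' T')"
    using G(3) by (simp add: iso_def car)
  have \<alpha>_hom: "\<alpha> \<in> hom G G''" using G(3) by (simp add: iso_def)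
  have \<alpha>: "\<alpha> x f = f x" if "f \<in> characters G T" for x f
    using G.evaluation_apply[OF that] by (simp add: \<alpha>_def)
  have \<beta>: "\<beta> f \<psi> = \<psi> f" if "\<psi> \<in> characters G' T'" for f \<psi>
    using G'.evaluation_apply[OF that] by (simp add: \<beta>_def)
  have \<alpha>_char: "\<alpha> x \<in> characters G' T'" if "x \<in> carrier G" for x
    using \<alpha>_bij that by (auto simp: bij_betw_def)
  have \<beta>_char: "\<beta> f \<in> characters G'' T''" if "f \<in> characters G T" for f
    using G'.evaluation_character[of f] that by (simp add: car \<beta>_def G''_def T''_def)
  have \<beta>\<alpha>: "\<beta> f (\<alpha> x) = f x" if "f \<in> characters G T" "x \<in> carrier G" for f x
    using \<alpha>[OF that(1)] \<beta>[OF \<alpha>_char[OF that(2)]] by simp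
  have bij: "bij_betw \<beta> (characters G T) (characters G'' T'')"
  proof (rule bij_betwI')
    fix f g assume fg: "f \<in> characters G T" "g \<in> characters G T"
    show "\<beta> f = \<beta> g \<longleftrightarrow> f = g"
    proof
      assume eq: "\<beta> f = \<beta> g"
      show "f = g"
      proof (rule extensionalityI)
        show "f x = g x" if "x \<in> carrier G" for x
          using \<beta>\<alpha>[OF fg(1) that] \<beta>\<alpha>[OF fg(2) that] eq by simp
      qed (use fg charactersD(2) in auto)
    qed simp
  next
    fix \<Lambda> assume \<Lambda>: "\<Lambda> \<in> characters G'' T''"
    \<comment> \<open>The preimage of \<open>\<Lambda>\<close> under \<open>\<beta>\<close> is its
      pullback along \<open>\<alpha>\<close>.\<close>
    define f where "f = (\<lambda>x\<in>carrier G. \<Lambda> (\<alpha> x))"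
    have f: "f \<in> characters G T"
    proof (rule charactersI)
      show "f \<in> hom G circle_group"
      proof (rule G.circle_homI)
        show "norm (f x) = 1" if "x \<in> carrier G" for x
          using G''.circle_hom_norm[OF charactersD(1)[OF \<Lambda>]] \<alpha>_char[OF that] that by (simp add: f_def car)
        show "f (x \<otimes> y) = f x * f y" if "x \<in> carrier G" "y \<in> carrier G" for x y
          using G''.circle_hom_mult[OF charactersD(1)[OF \<Lambda>]] \<alpha>_char that hom_mult[OF \<alpha>_hom] by (simp add: f_def car)
      qed
      have "continuous_map T euclidean (\<Lambda> \<circ> \<alpha>)"
        using homeomorphic_imp_continuous_map[OF G(4)] charactersD(3)[OF \<Lambda>] by (rule continuous_map_compose)
      then show "continuous_map T euclidean f"
        by (rule continuous_map_eq) (simp add: f_def G.topspace_eq)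
    qed (auto simp: f_def G.topspace_eq)
    have "\<Lambda> = \<beta> f"
    proof (rule extensionalityI)
      fix \<psi> assume "\<psi> \<in> carrier G''"
      then obtain x where x: "x \<in> carrier G" "\<psi> = \<alpha> x" using \<alpha>_bij by (auto simp: car bij_betw_def)
      then show "\<Lambda> \<psi> = \<beta> f \<psi>" using \<beta>\<alpha>[OF f x(1)] by (simp add: f_def)
    qed (use charactersD(2)[OF \<Lambda>] charactersD(2)[OF \<beta>_char[OF f]] in auto)
    then show "\<exists>f\<in>characters G T. \<Lambda> = \<beta> f" using f by blast
  qed (rule \<beta>_char)
  have nbhd: "{\<Lambda> \<in> characters G'' T''. \<forall>\<psi>\<in>\<alpha> ` K. dist (\<Lambda> \<psi>) (\<beta> f \<psi>) < e}
      = \<beta> ` {g \<in> characters G T. \<forall>x\<in>K. dist (g x) (f x) < e}"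
    if f: "f \<in> characters G T" and K: "K \<subseteq> carrier G" for f K e
  proof -
    have "characters G'' T'' = \<beta> ` characters G T" using bij by (simp add: bij_betw_def)
    then show ?thesis using \<beta>\<alpha> f K by (fastforce simp: subset_iff)
  qed
  have "homeomorphic_map T' (dual_topology G'' T'') \<beta>"
  proof (rule homeomorphic_map_if_open_iff)
    show "bij_betw \<beta> (topspace T') (topspace (dual_topology G'' T''))"
      using bij by (simp add: T'_def)
    fix U assume "U \<subseteq> topspace T'"
    then have U: "U \<subseteq> characters G T" by (simp add: T'_def)
    have inj: "\<beta> ` A \<subseteq> \<beta> ` U \<longleftrightarrow> A \<subseteq> U" if "A \<subseteq> characters G T" for A
      using inj_on_image_subset_iff[OF bij_betw_imp_inj_on[OF bij] that U] .
    have "(\<exists>K e. compactin T K \<and> e > 0 \<and> {g \<in> characters G T. \<forall>x\<in>K. dist (g x) (f x) < e} \<subseteq> U) \<longleftrightarrow>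
      (\<exists>K e. compactin T'' K \<and> e > 0 \<and> {\<Lambda> \<in> characters G'' T''. \<forall>\<psi>\<in>K. dist (\<Lambda> \<psi>) (\<beta> f \<psi>) < e} \<subseteq> \<beta> ` U)"
      (is "?L \<longleftrightarrow> ?R") if "f \<in> U" for f
    proof
      assume ?L
      then obtain K e where K: "compactin T K" "e > 0" "{g \<in> characters G T. \<forall>x\<in>K. dist (g x) (f x) < e} \<subseteq> U"
        by blast
      have "K \<subseteq> carrier G" using compactin_subset_topspace[OF K(1)] G.topspace_eq by simp
      then have "{\<Lambda> \<in> characters G'' T''. \<forall>\<psi>\<in>\<alpha> ` K. dist (\<Lambda> \<psi>) (\<beta> f \<psi>) < e} \<subseteq> \<beta> ` U"
        using nbhd[of f K e] image_mono[OF K(3), of \<beta>] that U by blast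
      moreover have "compactin T'' (\<alpha> ` K)"
        using image_compactin[OF K(1) homeomorphic_imp_continuous_map[OF G(4)]] .
      ultimately show ?R using K(2) by blast
    next
      assume ?R
      then obtain K e where K: "compactin T'' K" "e > 0"
        "{\<Lambda> \<in> characters G'' T''. \<forall>\<psi>\<in>K. dist (\<Lambda> \<psi>) (\<beta> f \<psi>) < e} \<subseteq> \<beta> ` U" by blast
      \<comment> \<open>Through the continuous inverse \<open>\<gamma>\<close>, every compact set of
        the bidual is the image of a compact set of \<open>G\<close>.\<close>
      obtain \<gamma> where \<gamma>: "homeomorphic_maps T T'' \<alpha> \<gamma>" using G(4) homeomorphic_map_maps by blast
      have K': "compactin T (\<gamma> ` K)"
        using image_compactin[OF K(1)] \<gamma> by (auto simp: homeomorphic_maps_def)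
      have "\<alpha> ` \<gamma> ` K = K"
        using \<gamma> compactin_subset_topspace[OF K(1)] by (force simp: homeomorphic_maps_def image_image)
      moreover have K'_sub: "\<gamma> ` K \<subseteq> carrier G" using compactin_subset_topspace[OF K'] G.topspace_eq by simp
      ultimately have "\<beta> ` {g \<in> characters G T. \<forall>x\<in>\<gamma> ` K. dist (g x) (f x) < e} \<subseteq> \<beta> ` U"
        using nbhd[OF subsetD[OF U that] K'_sub, of e] K(3) by simp
      then have "{g \<in> characters G T. \<forall>x\<in>\<gamma> ` K. dist (g x) (f x) < e} \<subseteq> U"
        by (subst (asm) inj) auto
      then show ?L using K' K(2) by blast
    qed
    then show "openin T' U \<longleftrightarrow> openin (dual_topology G'' T'') (\<beta> ` U)"
      unfolding T'_def openin_dual_topology using U \<beta>_char by auto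
  qed
  moreover have "\<beta> \<in> iso G' (dual_group G'' T'')"
    using G'.evaluation_hom_hom bij
    by (simp add: iso_def \<beta>_def G''_def T''_def bidual_group_def car)
  ultimately show ?thesis
    unfolding reflexive_group_def bidual_group_def bidual_topology_def
    using G.comm_group_dual G.topological_group_dual
    by (simp add: G'_def T'_def G''_def T''_def \<beta>_def)
qed

subsection \<open>The \<open>P\<close>-modification of a product of discrete groups\<close>

locale discrete_product =
  fixes I :: "'i set" and D :: "'i \<Rightarrow> 'a monoid"
  assumes factor_comm_group: "i \<in> I \<Longrightarrow> comm_group (D i)"
begin

definition G :: "('i \<Rightarrow> 'a) monoid" where "G = product_group I D"

definition T :: "('i \<Rightarrow> 'a) topology" where
  "T = P_modification (product_topology (\<lambda>i. discrete_topology (carrier (D i))) I)"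

definition cylinder :: "('i \<Rightarrow> 'a) \<Rightarrow> 'i set \<Rightarrow> ('i \<Rightarrow> 'a) set" where
  "cylinder x J = {y \<in> carrier G. \<forall>j\<in>J. y j = x j}"

lemma factor_group: "i \<in> I \<Longrightarrow> group (D i)"
  using factor_comm_group comm_group.axioms(2) by blast

lemma carrier_G: "carrier G = (\<Pi>\<^sub>E i\<in>I. carrier (D i))"
  by (simp add: G_def)

lemma G_coord: "x \<in> carrier G \<Longrightarrow> i \<in> I \<Longrightarrow> x i \<in> carrier (D i)"
  by (auto simp: carrier_G)

lemma G_eqI: "x \<in> carrier G \<Longrightarrow> y \<in> carrier G \<Longrightarrow> (\<And>i. i \<in> I \<Longrightarrow> x i = y i) \<Longrightarrow> x = y"
  unfolding carrier_G by (rule PiE_ext)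

lemma G_mult_apply: "i \<in> I \<Longrightarrow> (x \<otimes>\<^bsub>G\<^esub> y) i = x i \<otimes>\<^bsub>D i\<^esub> y i"
  by (simp add: G_def)

lemma G_one_apply: "i \<in> I \<Longrightarrow> \<one>\<^bsub>G\<^esub> i = \<one>\<^bsub>D i\<^esub>"
  by (simp add: G_def)

lemma comm_group_G: "comm_group G"
proof (rule group.group_comm_groupI)
  show "group G" unfolding G_def using factor_group by simp
  fix x y assume "x \<in> carrier G" "y \<in> carrier G"
  then show "x \<otimes>\<^bsub>G\<^esub> y = y \<otimes>\<^bsub>G\<^esub> x"
    using comm_monoid.m_comm[OF comm_group.axioms(1)[OF factor_comm_group]] G_coord
    by (auto simp: G_def fun_eq_iff)
qed

sublocale G: comm_group G by (rule comm_group_G)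

lemma G_inv_apply: "x \<in> carrier G \<Longrightarrow> i \<in> I \<Longrightarrow> (inv\<^bsub>G\<^esub> x) i = inv\<^bsub>D i\<^esub> (x i)"
  using inv_product_group[of x I D] factor_group by (simp add: G_def)

lemma topspace_T: "topspace T = carrier G"
  by (simp add: T_def carrier_G)

lemma cylinder_gdelta:
  assumes x: "x \<in> carrier G" and J: "countable J" "J \<subseteq> I"
  shows "gdelta_in (product_topology (\<lambda>i. discrete_topology (carrier (D i))) I) (cylinder x J)"
    (is "gdelta_in ?P _")
proof (cases "J = {}")
  case True
  then have "cylinder x J = topspace ?P" by (simp add: cylinder_def carrier_G)
  then show ?thesis by (simp only: gdelta_in_topspace)
next
  case False
  have "openin ?P {y \<in> topspace ?P. y j \<in> {x j}}" if "j \<in> J" for j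
    using that J(2) G_coord[OF x]
    by (intro openin_continuous_map_preimage[OF continuous_map_product_projection]) auto
  then have "gdelta_in ?P {y \<in> carrier G. y j = x j}" if "j \<in> J" for j
    using that by (auto simp: carrier_G intro!: open_imp_gdelta_in)
  then have "gdelta_in ?P (\<Inter>j\<in>J. {y \<in> carrier G. y j = x j})"
    using J(1) False by (intro gdelta_in_Inter) auto
  also have "(\<Inter>j\<in>J. {y \<in> carrier G. y j = x j}) = cylinder x J" using False by (auto simp: cylinder_def)
  finally show ?thesis .
qed

text \<open>Each of the countably many open sets restricts finitely many coordinates near
  \<open>x\<close>; \<open>J\<close> is the union of these finite sets.\<close>

lemma gdelta_contains_cylinder:
  assumes W: "gdelta_in (product_topology (\<lambda>i. discrete_topology (carrier (D i))) I) W"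
    and x: "x \<in> W"
  obtains J where "countable J" "J \<subseteq> I" "cylinder x J \<subseteq> W"
proof -
  let ?P = "product_topology (\<lambda>i. discrete_topology (carrier (D i))) I"
  obtain \<U> where \<U>: "countable \<U>" "\<And>V. V \<in> \<U> \<Longrightarrow> openin ?P V" "\<Inter>\<U> = W"
    using W unfolding gdelta_in_alt intersection_of_def by blast
  have "\<exists>J. finite J \<and> J \<subseteq> I \<and> cylinder x J \<subseteq> V" if V: "V \<in> \<U>" for V
  proof -
    have "x \<in> V" using x \<U>(3) V by auto
    then obtain X where X: "finite {i \<in> I. X i \<noteq> carrier (D i)}" "x \<in> Pi\<^sub>E I X" "Pi\<^sub>E I X \<subseteq> V"
      using \<U>(2)[OF V] unfolding openin_product_topology_alt by (auto simp: topspace_discrete_topology)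
    have "cylinder x {i \<in> I. X i \<noteq> carrier (D i)} \<subseteq> Pi\<^sub>E I X"
    proof
      fix y assume y: "y \<in> cylinder x {i \<in> I. X i \<noteq> carrier (D i)}"
      have "y i \<in> X i" if "i \<in> I" for i
        using y X(2) that by (cases "X i = carrier (D i)") (auto simp: cylinder_def carrier_G)
      moreover have "y \<in> extensional I" using y by (auto simp: cylinder_def carrier_G PiE_def)
      ultimately show "y \<in> Pi\<^sub>E I X" by (auto simp: PiE_def)
    qed
    then show ?thesis using X by (intro exI[of _ "{i \<in> I. X i \<noteq> carrier (D i)}"]) auto
  qed
  then obtain J where J: "\<And>V. V \<in> \<U> \<Longrightarrow> finite (J V) \<and> J V \<subseteq> I \<and> cylinder x (J V) \<subseteq> V" by metis
  show thesis
  proof (rule that)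
    show "countable (\<Union>V\<in>\<U>. J V)" using \<U>(1) J by (auto intro: countable_finite)
    show "(\<Union>V\<in>\<U>. J V) \<subseteq> I" using J by blast
    have "cylinder x (\<Union>V\<in>\<U>. J V) \<subseteq> cylinder x (J V)" if "V \<in> \<U>" for V using that by (auto simp: cylinder_def)
    then have "cylinder x (\<Union>V\<in>\<U>. J V) \<subseteq> V" if "V \<in> \<U>" for V using J that by (meson order_trans)
    then show "cylinder x (\<Union>V\<in>\<U>. J V) \<subseteq> W" using \<U>(3) by blast
  qed
qed

text \<open>Cylinders over countable sets are G-delta in the product, and every G-delta set contains
  one around each of its points. This description replaces \<open>P_modification\<close> in the
  arguments about open sets below.\<close>

lemma openin_T:
  "openin T S \<longleftrightarrow> S \<subseteq> carrier G \<and> (\<forall>x\<in>S. \<exists>J. countable J \<and> J \<subseteq> I \<and> cylinder x J \<subseteq> S)"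
proof
  assume S: "openin T S"
  then obtain \<U> where \<U>: "\<And>W. W \<in> \<U> \<Longrightarrow>
      gdelta_in (product_topology (\<lambda>i. discrete_topology (carrier (D i))) I) W" "\<Union>\<U> = S"
    unfolding T_def openin_P_modification union_of_def by auto
  show "S \<subseteq> carrier G \<and> (\<forall>x\<in>S. \<exists>J. countable J \<and> J \<subseteq> I \<and> cylinder x J \<subseteq> S)"
  proof (intro conjI ballI)
    show "S \<subseteq> carrier G" using openin_subset[OF S] by (simp add: topspace_T)
    fix x assume "x \<in> S"
    then obtain W where W: "W \<in> \<U>" "x \<in> W" using \<U>(2) by blast
    then show "\<exists>J. countable J \<and> J \<subseteq> I \<and> cylinder x J \<subseteq> S"
      using gdelta_contains_cylinder[OF \<U>(1)[OF W(1)] W(2)] \<U>(2) by (metis Union_upper order_trans)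
  qed
next
  assume S: "S \<subseteq> carrier G \<and> (\<forall>x\<in>S. \<exists>J. countable J \<and> J \<subseteq> I \<and> cylinder x J \<subseteq> S)"
  show "openin T S"
  proof (subst openin_subopen, intro ballI)
    fix x assume x: "x \<in> S"
    then obtain J where J: "countable J" "J \<subseteq> I" "cylinder x J \<subseteq> S" using S by blast
    have "openin T (cylinder x J)"
      unfolding T_def openin_P_modification
      using cylinder_gdelta[OF _ J(1,2)] x S by (intro arbitrary_union_of_inc) auto
    moreover have "x \<in> cylinder x J" using x S by (auto simp: cylinder_def)
    ultimately show "\<exists>W. openin T W \<and> x \<in> W \<and> W \<subseteq> S" using J(3) by blast
  qed
qed

lemma cylinder_subset: "cylinder x J \<subseteq> carrier G"
  by (auto simp: cylinder_def)

lemma openin_cylinder: "countable J \<Longrightarrow> J \<subseteq> I \<Longrightarrow> openin T (cylinder x J)"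
  unfolding openin_T by (auto simp: cylinder_def)

lemma topological_group_G: "topological_group G T"
  unfolding topological_group_def
proof (intro conjI)
  show "group G" by (rule G.is_group)
  show "topspace T = carrier G" by (rule topspace_T)
  show "continuous_map (prod_topology T T) T (\<lambda>(x, y). x \<otimes>\<^bsub>G\<^esub> y)"
    unfolding continuous_map_def
  proof (intro conjI allI impI)
    fix S assume S: "openin T S"
    show "openin (prod_topology T T) {p \<in> topspace (prod_topology T T). (case p of (x, y) \<Rightarrow> x \<otimes>\<^bsub>G\<^esub> y) \<in> S}"
      unfolding openin_prod_topology_alt
    proof (intro allI impI)
      fix x y assume "(x, y) \<in> {p \<in> topspace (prod_topology T T). (case p of (x, y) \<Rightarrow> x \<otimes>\<^bsub>G\<^esub> y) \<in> S}"
      then have xy: "x \<in> carrier G" "y \<in> carrier G" "x \<otimes>\<^bsub>G\<^esub> y \<in> S" by (auto simp: topspace_T)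
      then obtain J where J: "countable J" "J \<subseteq> I" "cylinder (x \<otimes>\<^bsub>G\<^esub> y) J \<subseteq> S"
        using S unfolding openin_T by blast
      have mult: "x' \<otimes>\<^bsub>G\<^esub> y' \<in> cylinder (x \<otimes>\<^bsub>G\<^esub> y) J" if "x' \<in> cylinder x J" "y' \<in> cylinder y J" for x' y'
      proof -
        have "(x' \<otimes>\<^bsub>G\<^esub> y') j = (x \<otimes>\<^bsub>G\<^esub> y) j" if "j \<in> J" for j
          using that J(2) \<open>x' \<in> cylinder x J\<close> \<open>y' \<in> cylinder y J\<close>
          by (simp add: cylinder_def G_mult_apply subset_iff)
        then show ?thesis using that by (simp add: cylinder_def)
      qed
      show "\<exists>U V. openin T U \<and> openin T V \<and> x \<in> U \<and> y \<in> V \<and>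
          U \<times> V \<subseteq> {p \<in> topspace (prod_topology T T). (case p of (x, y) \<Rightarrow> x \<otimes>\<^bsub>G\<^esub> y) \<in> S}"
      proof (intro exI conjI)
        show "openin T (cylinder x J)" "openin T (cylinder y J)" by (rule openin_cylinder[OF J(1,2)])+
        show "x \<in> cylinder x J" "y \<in> cylinder y J" using xy by (simp_all add: cylinder_def)
        show "cylinder x J \<times> cylinder y J \<subseteq>
            {p \<in> topspace (prod_topology T T). (case p of (x, y) \<Rightarrow> x \<otimes>\<^bsub>G\<^esub> y) \<in> S}"
          using mult J(3) cylinder_subset by (auto simp: topspace_T subset_iff)
      qed
    qed
  qed (auto simp: topspace_T)
  show "continuous_map T T (\<lambda>x. inv\<^bsub>G\<^esub> x)"
    unfolding continuous_map_def
  proof (intro conjI allI impI)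
    fix S assume S: "openin T S"
    show "openin T {x \<in> topspace T. inv\<^bsub>G\<^esub> x \<in> S}"
      unfolding openin_T
    proof (intro conjI ballI)
      fix x assume "x \<in> {x \<in> topspace T. inv\<^bsub>G\<^esub> x \<in> S}"
      then have x: "x \<in> carrier G" "inv\<^bsub>G\<^esub> x \<in> S" by (auto simp: topspace_T)
      then obtain J where J: "countable J" "J \<subseteq> I" "cylinder (inv\<^bsub>G\<^esub> x) J \<subseteq> S"
        using S unfolding openin_T by blast
      have "inv\<^bsub>G\<^esub> y \<in> cylinder (inv\<^bsub>G\<^esub> x) J" if "y \<in> cylinder x J" for y
        using that J(2) x by (auto simp: cylinder_def G_inv_apply subset_iff)
      then show "\<exists>J. countable J \<and> J \<subseteq> I \<and> cylinder x J \<subseteq> {x \<in> topspace T. inv\<^bsub>G\<^esub> x \<in> S}"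
        using J by (intro exI[of _ J]) (auto simp: topspace_T cylinder_def)
    qed (auto simp: topspace_T)
  qed (auto simp: topspace_T)
qed

sublocale G: group_with_topology G T
  by unfold_locales (rule topspace_T)

text \<open>A countable union of countable sets of coordinates is countable, so countably many
  cylinders around a point contain a common one.\<close>

lemma P_group_G: "P_group G T"
  unfolding P_group_def
proof (intro conjI allI impI)
  fix S assume S: "gdelta_in T S"
  obtain \<U> where \<U>: "countable \<U>" "\<And>V. V \<in> \<U> \<Longrightarrow> openin T V" "\<Inter>\<U> = S"
    using S unfolding gdelta_in_alt intersection_of_def by blast
  show "openin T S"
    unfolding openin_T
  proof (intro conjI ballI)
    show "S \<subseteq> carrier G" using gdelta_in_subset[OF S] by (simp add: topspace_T)
    fix x assume x: "x \<in> S"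
    have "\<exists>J. countable J \<and> J \<subseteq> I \<and> cylinder x J \<subseteq> V" if "V \<in> \<U>" for V
      using \<U>(2)[OF that] x \<U>(3) that unfolding openin_T by blast
    then obtain J where J: "\<And>V. V \<in> \<U> \<Longrightarrow> countable (J V) \<and> J V \<subseteq> I \<and> cylinder x (J V) \<subseteq> V" by metis
    have "cylinder x (\<Union>V\<in>\<U>. J V) \<subseteq> cylinder x (J V)" if "V \<in> \<U>" for V using that by (auto simp: cylinder_def)
    then have "cylinder x (\<Union>V\<in>\<U>. J V) \<subseteq> V" if "V \<in> \<U>" for V using J that by (meson order_trans)
    then have "cylinder x (\<Union>V\<in>\<U>. J V) \<subseteq> S" using \<U>(3) by blast
    moreover have "countable (\<Union>V\<in>\<U>. J V)" "(\<Union>V\<in>\<U>. J V) \<subseteq> I" using \<U>(1) J by auto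
    ultimately show "\<exists>J. countable J \<and> J \<subseteq> I \<and> cylinder x J \<subseteq> S" by blast
  qed
qed (rule topological_group_G)

text \<open>One coordinate for each pair of points of a countable \<open>C\<close> gives a countable
  \<open>J\<close> that separates \<open>C\<close>. The open cylinders over \<open>J\<close> contain
  at most one point of \<open>C\<close> each, and finitely many of them cover
  \<open>K\<close>.\<close>

lemma finite_if_compactin:
  assumes K: "compactin T K"
  shows "finite K"
proof (rule ccontr)
  assume "infinite K"
  then obtain C where C: "C \<subseteq> K" "countable C" "infinite C" using infinite_countable_subset' by blast
  have Kc: "K \<subseteq> carrier G" using compactin_subset_topspace[OF K] by (simp add: topspace_T)
  have "\<exists>i\<in>I. x i \<noteq> y i" if "x \<in> C" "y \<in> C" "x \<noteq> y" for x y
    using G_eqI[of x y] that C(1) Kc by blast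
  then obtain i where i: "\<And>x y. x \<in> C \<Longrightarrow> y \<in> C \<Longrightarrow> x \<noteq> y \<Longrightarrow> i x y \<in> I \<and> x (i x y) \<noteq> y (i x y)"
    by metis
  define J where "J = (\<lambda>(x, y). i x y) ` {(x, y) \<in> C \<times> C. x \<noteq> y}"
  have "countable {(x, y) \<in> C \<times> C. x \<noteq> y}"
    by (rule countable_subset[of _ "C \<times> C"]) (use C(2) in auto)
  then have J: "countable J" "J \<subseteq> I"
    unfolding J_def using i by auto
  have inj: "x = y" if "x \<in> C" "y \<in> C" "\<forall>j\<in>J. x j = y j" for x y
    using i[of x y] that unfolding J_def by force
  have cover: "K \<subseteq> \<Union>((\<lambda>x. cylinder x J) ` K)" using Kc by (auto simp: cylinder_def)
  have "openin T V" if "V \<in> (\<lambda>x. cylinder x J) ` K" for V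
    using that openin_cylinder[OF J] by auto
  from compactinD[OF K this cover] obtain \<F> where \<F>: "finite \<F>" "\<F> \<subseteq> (\<lambda>x. cylinder x J) ` K" "K \<subseteq> \<Union>\<F>"
    by blast
  then have "\<forall>x\<in>C. \<exists>V. V \<in> \<F> \<and> x \<in> V" using C(1) by blast
  from bchoice[OF this] obtain b where b: "\<And>x. x \<in> C \<Longrightarrow> b x \<in> \<F> \<and> x \<in> b x" by blast
  have "inj_on b C"
  proof (rule inj_onI)
    fix x y assume xy: "x \<in> C" "y \<in> C" "b x = b y"
    obtain z where "b x = cylinder z J" using b[OF xy(1)] \<F>(2) by auto
    then have "\<forall>j\<in>J. x j = y j" using b[OF xy(1)] b[OF xy(2)] xy(3) by (auto simp: cylinder_def)
    then show "x = y" using inj xy by blast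
  qed
  then have "finite C" using inj_on_finite[of b C \<F>] b \<F>(1) by blast
  then show False using C(3) by blast
qed

section \<open>The basic subgroups of \<open>G\<close> and their annihilators\<close>

definition U :: "'i set \<Rightarrow> ('i \<Rightarrow> 'a) set" where
  "U J = cylinder \<one>\<^bsub>G\<^esub> J"

abbreviation A :: "'i set \<Rightarrow> (('i \<Rightarrow> 'a) \<Rightarrow> complex) set" where
  "A J \<equiv> annihilator G (U J)"

lemma U_iff: "J \<subseteq> I \<Longrightarrow> x \<in> U J \<longleftrightarrow> x \<in> carrier G \<and> (\<forall>j\<in>J. x j = \<one>\<^bsub>D j\<^esub>)"
  by (auto simp: U_def cylinder_def G_one_apply subset_iff)

lemma U_subset: "U J \<subseteq> carrier G"
  by (auto simp: U_def cylinder_def)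

lemma U_antimono: "J \<subseteq> L \<Longrightarrow> U L \<subseteq> U J"
  by (auto simp: U_def cylinder_def)

lemma A_mono: "J \<subseteq> L \<Longrightarrow> A J \<subseteq> A L"
  using U_antimono[of J L] by (auto simp: annihilator_def)

lemma subgroup_U:
  assumes J: "J \<subseteq> I"
  shows "subgroup (U J) G"
proof (rule G.subgroupI)
  show "U J \<noteq> {}" using U_iff[OF J, of "\<one>\<^bsub>G\<^esub>"] J by (auto simp: G_one_apply subset_iff)
  fix x y assume x: "x \<in> U J" and y: "y \<in> U J"
  show "inv\<^bsub>G\<^esub> x \<in> U J"
    using x J by (auto simp: U_iff G_inv_apply subset_iff monoid.inv_one group.is_monoid factor_group)
  show "x \<otimes>\<^bsub>G\<^esub> y \<in> U J"
    using x y J by (auto simp: U_iff G_mult_apply subset_iff factor_group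
        monoid.l_one monoid.one_closed group.is_monoid)
qed (rule U_subset)

lemma U_quotient_iff:
  assumes J: "J \<subseteq> I" and x: "x \<in> carrier G" and y: "y \<in> carrier G"
  shows "x \<otimes>\<^bsub>G\<^esub> inv\<^bsub>G\<^esub> y \<in> U J \<longleftrightarrow> (\<forall>j\<in>J. x j = y j)"
proof -
  have "x j \<otimes>\<^bsub>D j\<^esub> inv\<^bsub>D j\<^esub> (y j) = \<one>\<^bsub>D j\<^esub> \<longleftrightarrow> x j = y j" if "j \<in> J" for j
  proof -
    interpret Dj: group "D j" using factor_group J that by blast
    have "x j \<in> carrier (D j)" "y j \<in> carrier (D j)" using G_coord x y J that by auto
    then show ?thesis by (metis Dj.inv_closed Dj.inv_equality Dj.inv_inv Dj.r_inv)
  qed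
  then show ?thesis using J x y by (auto simp: U_iff G_mult_apply G_inv_apply subset_iff)
qed

lemma A_determined:
  assumes J: "J \<subseteq> I" and f: "f \<in> A J" and x: "x \<in> carrier G" and y: "y \<in> carrier G"
    and eq: "\<And>j. j \<in> J \<Longrightarrow> x j = y j"
  shows "f x = f y"
proof -
  note hom = G.annihilatorD(1)[OF f]
  have "f (x \<otimes>\<^bsub>G\<^esub> inv\<^bsub>G\<^esub> y) = 1"
    using U_quotient_iff[OF J x y] eq by (intro G.annihilatorD(2)[OF f]) auto
  then have "f x * inverse (f y) = 1"
    using x y by (simp add: G.circle_hom_mult[OF hom] G.circle_hom_inv[OF hom])
  then show ?thesis using G.circle_hom_nonzero[OF hom y] by (simp add: field_simps)
qed

lemma A_separates:
  assumes J: "J \<subseteq> I" and x: "x \<in> carrier G" "x \<notin> U J"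
  obtains f where "f \<in> A J" "f x \<noteq> 1"
proof -
  obtain f where f: "f \<in> hom G circle_group" "\<And>h. h \<in> U J \<Longrightarrow> f h = 1" "f x \<noteq> 1"
    using G.character_separates[OF subgroup_U[OF J] x] by blast
  have "restrict f (carrier G) \<in> hom G circle_group"
    using f(1) by (intro G.circle_homI) (auto simp: G.circle_hom_norm G.circle_hom_mult)
  then have "restrict f (carrier G) \<in> A J"
    using f U_subset[of J] by (auto simp: annihilator_def subset_iff)
  then show thesis using that[of "restrict f (carrier G)"] f(3) x(1) by simp
qed

lemma A_separates_points:
  assumes J: "J \<subseteq> I" and x: "x \<in> carrier G" and y: "y \<in> carrier G" and "j \<in> J" "x j \<noteq> y j"
  obtains f where "f \<in> A J" "f x \<noteq> f y"
proof -
  have "x \<otimes>\<^bsub>G\<^esub> inv\<^bsub>G\<^esub> y \<notin> U J" using U_quotient_iff[OF J x y] assms(4,5) by blast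
  then obtain f where f: "f \<in> A J" "f (x \<otimes>\<^bsub>G\<^esub> inv\<^bsub>G\<^esub> y) \<noteq> 1"
    using A_separates[OF J, of "x \<otimes>\<^bsub>G\<^esub> inv\<^bsub>G\<^esub> y"] x y by auto
  note hom = G.annihilatorD(1)[OF f(1)]
  have "f (x \<otimes>\<^bsub>G\<^esub> inv\<^bsub>G\<^esub> y) = f x * inverse (f y)"
    using x y by (simp add: G.circle_hom_mult[OF hom] G.circle_hom_inv[OF hom])
  then have "f x \<noteq> f y" using f(2) G.circle_hom_nonzero[OF hom y] by (metis right_inverse)
  then show thesis using f(1) by (rule that[rotated])
qed

lemma A_characters:
  assumes J: "countable J" "J \<subseteq> I"
  shows "A J \<subseteq> characters G T"
proof
  fix f assume f: "f \<in> A J"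
  have "continuous_map T euclidean f"
    unfolding continuous_map_def
  proof (intro conjI allI impI)
    fix V assume "openin euclidean (V :: complex set)"
    have "cylinder x J \<subseteq> {x \<in> topspace T. f x \<in> V}" if "x \<in> {x \<in> topspace T. f x \<in> V}" for x
    proof
      fix y assume y: "y \<in> cylinder x J"
      then have "f y = f x" using that by (intro A_determined[OF J(2) f]) (auto simp: cylinder_def topspace_T)
      then show "y \<in> {x \<in> topspace T. f x \<in> V}" using that y by (simp add: cylinder_def topspace_T)
    qed
    then show "openin T {x \<in> topspace T. f x \<in> V}"
      unfolding openin_T using J topspace_T by blast
  qed auto
  then show "f \<in> characters G T"
    using f by (intro charactersI) (auto simp: annihilator_def topspace_T)
qed

lemma characters_A:
  assumes f: "f \<in> characters G T"
  obtains J where "countable J" "J \<subseteq> I" "f \<in> A J"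
proof -
  have "openin T {x \<in> topspace T. f x \<in> ball 1 1}"
    using charactersD(3)[OF f] by (rule openin_continuous_map_preimage) simp
  moreover have "\<one>\<^bsub>G\<^esub> \<in> {x \<in> topspace T. f x \<in> ball 1 1}"
    using G.circle_hom_one[OF charactersD(1)[OF f]] by (simp add: topspace_T)
  ultimately obtain J where J: "countable J" "J \<subseteq> I" "U J \<subseteq> {x \<in> topspace T. f x \<in> ball 1 1}"
    unfolding openin_T U_def by blast
  note hom = charactersD(1)[OF f]
  interpret UJ: subgroup "U J" G by (rule subgroup_U[OF J(2)])
  have "f h = 1" if h: "h \<in> U J" for h
  proof (rule unit_eq_one_if_powers_near_one)
    have hc: "h \<in> carrier G" using h U_subset by blast
    show "norm (f h) = 1" using G.circle_hom_norm[OF hom hc] .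
    fix n :: nat
    \<comment> \<open>The powers of \<open>h\<close> stay in the region where \<open>f\<close> is
      within distance 1 of 1.\<close>
    have "h [^]\<^bsub>G\<^esub> n \<in> U J" by (induction n) (use h in auto)
    then have "dist 1 (f (h [^]\<^bsub>G\<^esub> n)) < 1" using J(3) by auto
    then show "norm (f h ^ n - 1) < 1"
      by (simp add: G.circle_hom_nat_pow[OF hom hc] dist_norm norm_minus_commute)
  qed
  then have "f \<in> A J" using f charactersD[OF f] by (simp add: annihilator_def)
  then show thesis using that J by blast
qed

end

subsection \<open>Compact sets of characters\<close>

context includes cardinal_syntax begin

text \<open>\<open>cardSuc natLeq\<close> is the cardinal omega_1, realised on sets of naturals
  because \<open>cardSuc\<close> passes from a type to its sets. In a cardinal order a proper
  initial segment has smaller cardinality, which here means countable.\<close>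

lemma uncountable_wellorder_countable_segments:
  obtains r :: "nat set rel"
  where "wf (r - Id)" "\<And>a b. a \<in> Field r \<Longrightarrow> b \<in> Field r \<Longrightarrow> a \<in> underS r b \<or> a = b \<or> b \<in> underS r a"
    "\<And>a b c. a \<in> underS r b \<Longrightarrow> b \<in> underS r c \<Longrightarrow> a \<in> underS r c"
    "uncountable (Field r)" "\<And>a. a \<in> Field r \<Longrightarrow> countable (underS r a)"
proof -
  define r where "r = cardSuc natLeq"
  have co: "Card_order r" unfolding r_def by (rule cardSuc_Card_order[OF natLeq_Card_order])
  then have wo: "Well_order r" by (rule card_order_on_well_order_on)
  have trans: "trans r" and antisym: "antisym r" and total: "total_on (Field r) r"
    using wo by (auto simp: well_order_on_def linear_order_on_def partial_order_on_def preorder_on_def)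
  show thesis
  proof (rule that)
    show "wf (r - Id)" using wo by (simp add: well_order_on_def)
    show "a \<in> underS r b \<or> a = b \<or> b \<in> underS r a" if "a \<in> Field r" "b \<in> Field r" for a b
      using total that by (auto simp: total_on_def underS_def)
    show "a \<in> underS r c" if "a \<in> underS r b" "b \<in> underS r c" for a b c
      using that trans antisym unfolding underS_def by (auto dest: transD antisymD)
    show "countable (underS r a)" if "a \<in> Field r" for a
    proof -
      have "|underS r a| <o r" by (rule card_of_underS[OF co that])
      then have "|underS r a| \<le>o natLeq"
        unfolding r_def using cardSuc_ordLeq_ordLess[OF natLeq_Card_order card_of_Card_order] by blast
      then show ?thesis by (simp add: countable_card_le_natLeq)
    qed
    show "uncountable (Field r)"
    proof
      assume "countable (Field r)"
      then have "|Field r| \<le>o natLeq" by (simp add: countable_card_le_natLeq)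
      moreover have "natLeq <o r" unfolding r_def by (rule cardSuc_greater[OF natLeq_Card_order])
      moreover have "|Field r| =o r" by (rule card_of_Field_ordIso[OF co])
      ultimately show False
        using not_ordLess_ordLeq ordIso_ordLeq_trans ordIso_symmetric by blast
    qed
  qed
qed

end

text \<open>Membership of \<open>a\<close> is decided by the part of \<open>N\<close> below
  \<open>a\<close>, a recursion on the characteristic function. It will express a greedy choice
  along the well-order.\<close>

lemma wf_recursive_set:
  assumes "wf (r - Id)"
  obtains N where "\<And>a. a \<in> N \<longleftrightarrow> P a (N \<inter> underS r a)"
proof -
  define f where "f = wfrec (r - Id) (\<lambda>f a. P a {b \<in> underS r a. f b})"
  have f: "f a = P a {b \<in> underS r a. f b}" for a
  proof -
    have "{b \<in> underS r a. cut f (r - Id) a b} = {b \<in> underS r a. f b}"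
      by (auto simp: cut_def underS_def)
    moreover have "f a = P a {b \<in> underS r a. cut f (r - Id) a b}"
      unfolding f_def by (rule wfrec[OF assms])
    ultimately show ?thesis by simp
  qed
  have "{b \<in> underS r a. f b} = {a. f a} \<inter> underS r a" for a by auto
  then have "a \<in> {a. f a} \<longleftrightarrow> P a ({a. f a} \<inter> underS r a)" for a using f[of a] by simp
  then show thesis by (rule that)
qed

context discrete_product begin

text \<open>If no countable set of coordinates carries all of \<open>K\<close>, a transfinite construction of length
  \<open>\<omega>\<^sub>1\<close> yields characters \<open>\<xi> \<alpha> \<in> K\<close> and points \<open>p \<alpha>\<close> with disjoint countable supports
  \<open>E \<alpha>\<close> such that \<open>\<xi> \<alpha>\<close> moves \<open>p \<alpha>\<close> and ignores all later points. Every subfamily of the points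
  has a product in \<open>G\<close>; choosing a subfamily greedily gives a point at which uncountably many
  \<open>\<xi> \<alpha>\<close> stay away from \<open>1\<close> while a prescribed character takes the value \<open>1\<close>. Hence the
  \<open>\<xi> \<alpha>\<close> have no complete accumulation point.\<close>

lemma compact_characters_countable_support:
  assumes K: "compactin (dual_topology G T) K"
  shows "\<exists>J. countable J \<and> J \<subseteq> I \<and> K \<subseteq> A J"
proof (rule ccontr)
  assume no: "\<nexists>J. countable J \<and> J \<subseteq> I \<and> K \<subseteq> A J"
  have K_char: "K \<subseteq> characters G T" using compactin_subset_topspace[OF K] by simp
  have step: "\<exists>f x L. f \<in> K \<and> x \<in> carrier G \<and> countable L \<and> J \<subseteq> L \<and> L \<subseteq> I \<and> f \<in> A L \<and>
      (\<forall>i\<in>I. i \<notin> L - J \<longrightarrow> x i = \<one>\<^bsub>D i\<^esub>) \<and> norm (f x - 1) \<ge> 1"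
    if J: "countable J" "J \<subseteq> I" for J
  proof -
    obtain f where f: "f \<in> K" "f \<notin> A J" using no J by blast
    then have fc: "f \<in> characters G T" using K_char by blast
    note hom = charactersD(1)[OF fc]
    have "\<exists>h\<in>U J. f h \<noteq> 1" using f(2) hom charactersD(2)[OF fc] by (auto simp: annihilator_def)
    then obtain h where h: "h \<in> U J" "f h \<noteq> 1" by blast
    have hc: "h \<in> carrier G" using h(1) U_subset by blast
    \<comment> \<open>\<open>f h\<close> may be arbitrarily close to 1, but some power of
      \<open>h\<close>, still in \<open>U J\<close>, is moved to distance at least 1. The greedy
      choice relies on this uniform bound.\<close>
    obtain n :: nat where n: "norm (f h ^ n - 1) \<ge> 1"
      using unit_eq_one_if_powers_near_one[of "f h"] h(2) G.circle_hom_norm[OF hom hc] not_le by blast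
    interpret UJ: subgroup "U J" G by (rule subgroup_U[OF J(2)])
    define y where "y = h [^]\<^bsub>G\<^esub> n"
    have "y \<in> U J" unfolding y_def by (induction n) (use h in auto)
    then have y: "y \<in> carrier G" "\<And>j. j \<in> J \<Longrightarrow> y j = \<one>\<^bsub>D j\<^esub>" using U_iff[OF J(2)] by auto
    have fy: "norm (f y - 1) \<ge> 1" unfolding y_def using n by (simp add: G.circle_hom_nat_pow[OF hom hc])
    obtain L0 where L0: "countable L0" "L0 \<subseteq> I" "f \<in> A L0" using characters_A[OF fc] by blast
    \<comment> \<open>Cutting \<open>y\<close> down to the coordinates on which \<open>f\<close>
      depends keeps the value of \<open>f\<close> and makes the support of the point
      countable.\<close>
    define x where "x = (\<lambda>i\<in>I. if i \<in> L0 then y i else \<one>\<^bsub>D i\<^esub>)"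
    have xc: "x \<in> carrier G"
      unfolding carrier_G x_def using G_coord[OF y(1)] factor_group
      by (auto simp: monoid.one_closed group.is_monoid)
    have "f x = f y"
    proof (rule A_determined[OF L0(2,3) xc y(1)])
      show "x j = y j" if "j \<in> L0" for j using that L0(2) by (auto simp: x_def)
    qed
    then have "norm (f x - 1) \<ge> 1" using fy by simp
    moreover have "f \<in> A (L0 \<union> J)" using A_mono[of L0 "L0 \<union> J"] L0(3) by blast
    moreover have "\<forall>i\<in>I. i \<notin> (L0 \<union> J) - J \<longrightarrow> x i = \<one>\<^bsub>D i\<^esub>" using y(2) by (auto simp: x_def)
    moreover have "countable (L0 \<union> J)" "L0 \<union> J \<subseteq> I" "J \<subseteq> L0 \<union> J" using L0 J by auto
    ultimately show ?thesis using f(1) xc by blast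
  qed
  \<comment> \<open>\<open>J\<close> holds the coordinates used before, \<open>L\<close> those used
    once \<open>f\<close> and \<open>x\<close> have been added; the support of \<open>x\<close> lies
    in the difference.\<close>
  define Q where "Q J f x L \<longleftrightarrow> f \<in> K \<and> x \<in> carrier G \<and> countable L \<and> J \<subseteq> L \<and> L \<subseteq> I \<and> f \<in> A L \<and>
      (\<forall>i\<in>I. i \<notin> L - J \<longrightarrow> x i = \<one>\<^bsub>D i\<^esub>) \<and> norm (f x - 1) \<ge> 1" for J f x L
  have "\<exists>t. Q J (fst t) (fst (snd t)) (snd (snd t))" if "countable J" "J \<subseteq> I" for J
  proof -
    have "\<exists>f x L. Q J f x L" unfolding Q_def by (rule step[OF that])
    then show ?thesis by auto
  qed
  then have "\<forall>J\<in>{J. countable J \<and> J \<subseteq> I}. \<exists>t. Q J (fst t) (fst (snd t)) (snd (snd t))" by blast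
  from bchoice[OF this] obtain t
    where t: "\<forall>J\<in>{J. countable J \<and> J \<subseteq> I}. Q J (fst (t J)) (fst (snd (t J))) (snd (snd (t J)))" ..
  define c where "c J = fst (t J)" for J
  define q where "q J = fst (snd (t J))" for J
  define g where "g J = snd (snd (t J))" for J
  have Q: "Q J (c J) (q J) (g J)" if "countable J" "J \<subseteq> I" for J
    unfolding c_def q_def g_def using t that by simp
  obtain r :: "nat set rel" where r: "wf (r - Id)"
    "\<And>a b. a \<in> Field r \<Longrightarrow> b \<in> Field r \<Longrightarrow> a \<in> underS r b \<or> a = b \<or> b \<in> underS r a"
    "\<And>a b c. a \<in> underS r b \<Longrightarrow> b \<in> underS r c \<Longrightarrow> a \<in> underS r c"
    "uncountable (Field r)" "\<And>a. a \<in> Field r \<Longrightarrow> countable (underS r a)"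
    using uncountable_wellorder_countable_segments by blast
  define W where "W = Field r"
  have under_W: "underS r a \<subseteq> W" for a by (auto simp: underS_def W_def Field_def)
  \<comment> \<open>\<open>B a\<close> collects the coordinates used at all stages below
    \<open>a\<close>; it stays countable because \<open>a\<close> has countably many
    predecessors.\<close>
  define B where "B = wfrec (r - Id) (\<lambda>B a. \<Union>b\<in>underS r a. g (B b))"
  have B: "B a = (\<Union>b\<in>underS r a. g (B b))" for a
  proof -
    have "(\<Union>b\<in>underS r a. g (cut B (r - Id) a b)) = (\<Union>b\<in>underS r a. g (B b))"
      by (intro SUP_cong refl) (auto simp: cut_def underS_def)
    moreover have "B a = (\<Union>b\<in>underS r a. g (cut B (r - Id) a b))"
      unfolding B_def by (rule wfrec[OF r(1)])
    ultimately show ?thesis by simp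
  qed
  have B_ok: "countable (B a) \<and> B a \<subseteq> I" if "a \<in> W" for a
    using that
  proof (induction a rule: wf_induct_rule[OF r(1)])
    case (1 a)
    have "countable (g (B b)) \<and> g (B b) \<subseteq> I" if b: "b \<in> underS r a" for b
    proof -
      have ba: "(b, a) \<in> r - Id" using b by (auto simp: underS_def)
      have "b \<in> W" using b under_W by blast
      then have "countable (B b) \<and> B b \<subseteq> I" by (rule 1(1)[OF ba])
      then have "Q (B b) (c (B b)) (q (B b)) (g (B b))" using Q by blast
      then show ?thesis unfolding Q_def by (elim conjE) (intro conjI)
    qed
    then have "(\<Union>b\<in>underS r a. g (B b)) \<subseteq> I" "countable (\<Union>b\<in>underS r a. g (B b))"
      using r(5)[of a] 1(2) by (auto simp: W_def)
    then show ?case unfolding B[of a] by blast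
  qed
  define \<xi> where "\<xi> a = c (B a)" for a
  define p where "p a = q (B a)" for a
  define L where "L a = g (B a)" for a
  define E where "E a = L a - B a" for a
  have "Q (B a) (\<xi> a) (p a) (L a)" if "a \<in> W" for a
    using Q B_ok[OF that] by (simp add: \<xi>_def p_def L_def)
  then have P: "\<xi> a \<in> K" "p a \<in> carrier G" "countable (L a)" "L a \<subseteq> I" "\<xi> a \<in> A (L a)"
    "\<And>i. i \<in> I \<Longrightarrow> i \<notin> E a \<Longrightarrow> p a i = \<one>\<^bsub>D i\<^esub>" "norm (\<xi> a (p a) - 1) \<ge> 1" if "a \<in> W" for a
    using that unfolding Q_def E_def by blast+
  have L_B: "L b \<subseteq> B a" if "b \<in> underS r a" for a b using that by (subst B) (auto simp: L_def)
  have disj: "a = b" if "a \<in> W" "b \<in> W" "i \<in> E a" "i \<in> E b" for a b i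
    using r(2)[of a b] that L_B by (auto simp: E_def W_def)
  \<comment> \<open>\<open>X N\<close> is the infinite product of the points \<open>p a\<close> with
    \<open>a\<close> in \<open>N\<close>, formed coordinatewise: by \<open>disj\<close> at most one
    factor is nontrivial at each coordinate, and \<open>SOME\<close> picks its index.\<close>
  define X where "X N = (\<lambda>i\<in>I. if \<exists>a\<in>N. i \<in> E a then p (SOME a. a \<in> W \<and> i \<in> E a) i else \<one>\<^bsub>D i\<^esub>)" for N
  have X_in: "X N i = p a i" if "N \<subseteq> W" "a \<in> N" "i \<in> E a" "i \<in> I" for N a i
  proof -
    have "(SOME a. a \<in> W \<and> i \<in> E a) = a" using disj that by (intro some_equality) auto
    then show ?thesis using that by (auto simp: X_def)
  qed
  have X_out: "X N i = \<one>\<^bsub>D i\<^esub>" if "\<And>a. a \<in> N \<Longrightarrow> i \<notin> E a" "i \<in> I" for N i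
    using that by (auto simp: X_def)
  have X_car: "X N \<in> carrier G" if N: "N \<subseteq> W" for N
    unfolding carrier_G
  proof (rule PiE_I)
    fix i assume i: "i \<in> I"
    show "X N i \<in> carrier (D i)"
    proof (cases "\<exists>a\<in>N. i \<in> E a")
      case True
      then obtain a where a: "a \<in> N" "i \<in> E a" by blast
      then show ?thesis using X_in[OF N a i] G_coord[OF P(2) i, of a] N by auto
    next
      case False
      then show ?thesis using X_out[of N i] i monoid.one_closed[OF group.is_monoid[OF factor_group[OF i]]] by simp
    qed
  qed (simp add: X_def)
  \<comment> \<open>\<open>\<xi> a\<close> depends only on \<open>L a\<close>, which later supports
    avoid, so only earlier points and \<open>p a\<close> itself contribute.\<close>
  have split: "\<xi> a (X N) = \<xi> a (X (N \<inter> underS r a)) * (if a \<in> N then \<xi> a (p a) else 1)"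
    if a: "a \<in> W" and N: "N \<subseteq> W" for a N
  proof -
    define e where "e = (if a \<in> N then p a else \<one>\<^bsub>G\<^esub>)"
    have e: "e \<in> carrier G" using P(2)[OF a] by (simp add: e_def)
    have N': "N \<inter> underS r a \<subseteq> W" using N by auto
    have "X N i = (X (N \<inter> underS r a) \<otimes>\<^bsub>G\<^esub> e) i" if i: "i \<in> L a" for i
    proof -
      have iI: "i \<in> I" using i P(4)[OF a] by blast
      interpret Di: group "D i" by (rule factor_group[OF iI])
      have pc: "p b i \<in> carrier (D i)" if "b \<in> W" for b using G_coord[OF P(2)[OF that] iI] .
      have earlier: "b \<in> underS r a \<or> b = a" if "b \<in> W" "i \<in> E b" for b
        using r(2)[of b a] that a i L_B by (auto simp: W_def E_def)
      consider (lt) b where "b \<in> N" "i \<in> E b" "b \<in> underS r a" | (eq) "a \<in> N" "i \<in> E a"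
        | (none) "\<And>b. b \<in> N \<Longrightarrow> i \<notin> E b" using earlier N by blast
      then show ?thesis
      proof cases
        case lt
        then have "i \<notin> E a" using disj[of a b i] a N by (auto simp: underS_def)
        then have "e i = \<one>\<^bsub>D i\<^esub>" using P(6)[OF a iI] iI by (simp add: e_def G_one_apply)
        then show ?thesis
          using X_in[OF N lt(1,2) iI] X_in[OF N' _ lt(2) iI] lt pc[of b] N iI by (auto simp: G_mult_apply)
      next
        case eq
        have "i \<notin> E b" if "b \<in> N \<inter> underS r a" for b
          using disj[of a b i] a N eq that by (auto simp: underS_def)
        then have "X (N \<inter> underS r a) i = \<one>\<^bsub>D i\<^esub>" using iI by (intro X_out) auto
        then show ?thesis using X_in[OF N eq iI] eq pc[OF a] iI by (simp add: G_mult_apply e_def)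
      next
        case none
        have "e i = \<one>\<^bsub>D i\<^esub>" using none P(6)[OF a iI] iI by (auto simp: e_def G_one_apply)
        then show ?thesis using X_out[of N i] X_out[of "N \<inter> underS r a" i] none iI by (simp add: G_mult_apply)
      qed
    qed
    then have "\<xi> a (X N) = \<xi> a (X (N \<inter> underS r a) \<otimes>\<^bsub>G\<^esub> e)"
      by (intro A_determined[OF P(4)[OF a] P(5)[OF a] X_car[OF N] G.m_closed[OF X_car[OF N'] e]])
    also have "\<dots> = \<xi> a (X (N \<inter> underS r a)) * \<xi> a e"
      using G.circle_hom_mult[OF G.annihilatorD(1)[OF P(5)[OF a]] X_car[OF N'] e] .
    finally show ?thesis using G.circle_hom_one[OF G.annihilatorD(1)[OF P(5)[OF a]]] by (simp add: e_def)
  qed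
  have avoid: "\<exists>V. openin (dual_topology G T) V \<and> f \<in> V \<and> countable {a \<in> W. \<xi> a \<in> V}" if f: "f \<in> K" for f
  proof -
    have fc: "f \<in> characters G T" using f K_char by blast
    obtain J where J: "countable J" "J \<subseteq> I" "f \<in> A J" using characters_A[OF fc] by blast
    \<comment> \<open>Stages with support disjoint from \<open>J\<close> are invisible to
      \<open>f\<close>, so \<open>f\<close> will be 1 at any product of their points.\<close>
    define S where "S = {a \<in> W. E a \<inter> J = {}}"
    obtain N where N: "\<And>a. a \<in> N \<longleftrightarrow> a \<in> S \<and> norm (\<xi> a (X (N \<inter> underS r a)) - 1) < 1/2"
      using wf_recursive_set[OF r(1), of "\<lambda>a M. a \<in> S \<and> norm (\<xi> a (X M) - 1) < 1/2"] by blast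
    have NS: "N \<subseteq> S" using N by blast
    have NW: "N \<subseteq> W" using NS by (auto simp: S_def)
    have far: "norm (\<xi> a (X N) - 1) \<ge> 1/2" if a: "a \<in> S" for a
    proof (cases "a \<in> N")
      case True
      have aW: "a \<in> W" using a by (simp add: S_def)
      define w where "w = \<xi> a (X (N \<inter> underS r a))"
      have "norm w = 1"
        unfolding w_def using NW by (intro G.circle_hom_norm[OF G.annihilatorD(1)[OF P(5)[OF aW]]] X_car) auto
      have "norm (w - 1) < 1/2" using N[of a] True by (simp add: w_def)
      moreover have "norm (\<xi> a (p a) - 1) \<le> norm (w * \<xi> a (p a) - 1) + norm (w - 1)"
      proof -
        have "norm (\<xi> a (p a) - 1) = norm (w * (\<xi> a (p a) - 1))" using \<open>norm w = 1\<close> by (simp add: norm_mult)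
        also have "\<dots> = norm ((w * \<xi> a (p a) - 1) - (w - 1))" by (simp add: algebra_simps)
        also have "\<dots> \<le> norm (w * \<xi> a (p a) - 1) + norm (w - 1)" by (rule norm_triangle_ineq4)
        finally show ?thesis .
      qed
      moreover have "\<xi> a (X N) = w * \<xi> a (p a)" using split[OF aW NW] True by (simp add: w_def)
      ultimately show ?thesis using P(7)[OF aW] by simp
    next
      case False
      have aW: "a \<in> W" using a by (simp add: S_def)
      show ?thesis using split[OF aW NW] False N[of a] a by simp
    qed
    have "X N \<in> U J"
      unfolding U_iff[OF J(2)]
    proof (intro conjI ballI)
      fix j assume j: "j \<in> J"
      show "X N j = \<one>\<^bsub>D j\<^esub>" using NS j J(2) by (intro X_out) (auto simp: S_def)
    qed (rule X_car[OF NW])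
    then have fX: "f (X N) = 1" by (rule G.annihilatorD(2)[OF J(3)])
    define V where "V = {h \<in> characters G T. \<forall>x\<in>{X N}. dist (h x) (f x) < 1/2}"
    have "openin (dual_topology G T) V"
      unfolding V_def using X_car[OF NW] by (intro G.dual_nbhd_open fc) (simp add: topspace_T)
    moreover have "f \<in> V" using fc by (simp add: V_def)
    moreover have "countable {a \<in> W. \<xi> a \<in> V}"
    proof -
      \<comment> \<open>A stage caught by \<open>V\<close> lies outside \<open>S\<close>, so its
        support set meets \<open>J\<close>. These sets are disjoint and \<open>J\<close> is
        countable.\<close>
      have "\<forall>a\<in>{a \<in> W. \<xi> a \<in> V}. \<exists>i. i \<in> E a \<inter> J"
      proof
        fix a assume a: "a \<in> {a \<in> W. \<xi> a \<in> V}"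
        then have "norm (\<xi> a (X N) - 1) < 1/2" by (simp add: V_def fX dist_norm)
        then have "a \<notin> S" using far[of a] by auto
        then show "\<exists>i. i \<in> E a \<inter> J" using a by (auto simp: S_def)
      qed
      from bchoice[OF this] obtain k where k: "\<And>a. a \<in> {a \<in> W. \<xi> a \<in> V} \<Longrightarrow> k a \<in> E a \<inter> J" by blast
      have "inj_on k {a \<in> W. \<xi> a \<in> V}"
      proof (rule inj_onI)
        fix a b assume ab: "a \<in> {a \<in> W. \<xi> a \<in> V}" "b \<in> {a \<in> W. \<xi> a \<in> V}" "k a = k b"
        then show "a = b" using disj[of a b "k a"] k[OF ab(1)] k[OF ab(2)] by auto
      qed
      moreover have "countable (k ` {a \<in> W. \<xi> a \<in> V})"
        using k by (intro countable_subset[OF _ J(1)]) auto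
      ultimately show ?thesis by (metis countable_image_inj_on)
    qed
    ultimately show ?thesis by blast
  qed
  then have "\<forall>f\<in>K. \<exists>V. openin (dual_topology G T) V \<and> f \<in> V \<and> countable {a \<in> W. \<xi> a \<in> V}"
    by (intro ballI)
  from bchoice[OF this] obtain V where V0: "\<forall>f\<in>K. openin (dual_topology G T) (V f) \<and> f \<in> V f \<and>
      countable {a \<in> W. \<xi> a \<in> V f}" ..
  have V: "openin (dual_topology G T) (V f)" "f \<in> V f" "countable {a \<in> W. \<xi> a \<in> V f}" if "f \<in> K" for f
    using bspec[OF V0 that] by simp_all
  have open_cover: "openin (dual_topology G T) Z" if Z: "Z \<in> V ` K" for Z
  proof -
    obtain f where "f \<in> K" "Z = V f" using Z by (rule imageE)
    then show ?thesis using V[of f] by simp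
  qed
  have "K \<subseteq> \<Union>(V ` K)" using V by blast
  from compactinD[OF K open_cover this] obtain \<F>
    where \<F>: "finite \<F>" "\<F> \<subseteq> V ` K" "K \<subseteq> \<Union>\<F>" by blast
  \<comment> \<open>Finitely many neighbourhoods, each catching countably many stages, would catch
    all of \<open>W\<close>.\<close>
  have "W \<subseteq> (\<Union>Z\<in>\<F>. {a \<in> W. \<xi> a \<in> Z})" using \<F>(3) P(1) by blast
  moreover have "countable (\<Union>Z\<in>\<F>. {a \<in> W. \<xi> a \<in> Z})"
  proof (rule countable_UN[OF countable_finite[OF \<F>(1)]])
    fix Z assume "Z \<in> \<F>"
    then obtain f where "f \<in> K" "Z = V f" using \<F>(2) by blast
    then show "countable {a \<in> W. \<xi> a \<in> Z}" using V[of f] by simp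
  qed
  ultimately have "countable W" by (rule countable_subset)
  then show False using r(4) by (simp add: W_def)
qed

end

subsection \<open>Duality for the \<open>P\<close>-modification\<close>

context discrete_product begin

lemma compactin_A:
  assumes J: "countable J" "J \<subseteq> I"
  shows "compactin (dual_topology G T) (A J)"
proof -
  define P where "P = product_topology (\<lambda>_. top_of_set (sphere (0::complex) 1)) (carrier G)"
  have A: "compactin P (A J)" unfolding P_def by (rule G.compactin_annihilator[OF U_subset])
  define X where "X = subtopology P (A J)"
  have top: "topspace X = A J" using compactin_subset_topspace[OF A] by (auto simp: X_def)
  have coord: "continuous_map X euclidean (\<lambda>f. f x)" if "x \<in> carrier G" for x
    using continuous_map_product_projection[OF that, of "\<lambda>_. top_of_set (sphere (0::complex) 1)"]
    by (simp add: X_def P_def continuous_map_in_subtopology continuous_map_from_subtopology)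
  \<comment> \<open>Compact subsets of \<open>G\<close> are finite, so uniform closeness on them
    restricts finitely many coordinates; the identity carries compactness from the pointwise
    topology to the dual.\<close>
  have "continuous_map X (dual_topology G T) (\<lambda>f. f)"
  proof (rule G.continuous_map_into_dual)
    show "f \<in> characters G T" if "f \<in> topspace X" for f using that A_characters[OF J] top by blast
    fix f K and e :: real assume f: "f \<in> topspace X" and K: "compactin T K" and "e > 0"
    have K': "finite K" "K \<subseteq> carrier G"
      using finite_if_compactin[OF K] compactin_subset_topspace[OF K] topspace_T by auto
    have "openin X {g \<in> topspace X. g k \<in> ball (f k) e}" if "k \<in> K" for k
      using K'(2) that by (intro openin_continuous_map_preimage[OF coord]) auto
    then have "openin X (topspace X \<inter> (\<Inter>k\<in>K. {g \<in> topspace X. g k \<in> ball (f k) e}))"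
    proof (cases "K = {}")
      case False
      then show ?thesis using K'(1) \<open>\<And>k. k \<in> K \<Longrightarrow> openin X {g \<in> topspace X. g k \<in> ball (f k) e}\<close>
        by (intro openin_Int openin_topspace openin_Inter) auto
    qed simp
    then show "\<exists>V. openin X V \<and> f \<in> V \<and> (\<forall>g\<in>V. \<forall>k\<in>K. dist (g k) (f k) < e)"
      using f \<open>e > 0\<close>
      by (intro exI[of _ "topspace X \<inter> (\<Inter>k\<in>K. {g \<in> topspace X. g k \<in> ball (f k) e})"])
        (auto simp: dist_commute)
  qed
  moreover have "compactin X (A J)" using A by (simp add: X_def compactin_subtopology)
  ultimately show ?thesis using image_compactin[of X "A J" "dual_topology G T" "\<lambda>f. f"] by simp
qed

text \<open>Countably many characters lie in one \<open>A L\<close> with \<open>L\<close> countable.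
  It is compact, hence closed in the Hausdorff dual, and so contains the closure.\<close>

lemma omega_bounded_dual: "omega_bounded_group (dual_group G T) (dual_topology G T)"
  unfolding omega_bounded_group_def
proof (intro conjI allI impI)
  fix C assume C: "C \<subseteq> carrier (dual_group G T) \<and> countable C"
  have "\<forall>f\<in>C. \<exists>J. countable J \<and> J \<subseteq> I \<and> f \<in> A J"
  proof
    fix f assume "f \<in> C"
    then have "f \<in> characters G T" using C by auto
    then obtain J where "countable J" "J \<subseteq> I" "f \<in> A J" by (rule characters_A)
    then show "\<exists>J. countable J \<and> J \<subseteq> I \<and> f \<in> A J" by (intro exI[of _ J] conjI)
  qed
  from bchoice[OF this] obtain J where J: "\<forall>f\<in>C. countable (J f) \<and> J f \<subseteq> I \<and> f \<in> A (J f)" ..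
  define L where "L = (\<Union>f\<in>C. J f)"
  have L: "countable L" "L \<subseteq> I" using J C by (auto simp: L_def)
  have "C \<subseteq> A L"
  proof
    fix f assume f: "f \<in> C"
    then have "A (J f) \<subseteq> A L" by (intro A_mono) (auto simp: L_def)
    then show "f \<in> A L" using J f by blast
  qed
  moreover have "closedin (dual_topology G T) (A L)"
    by (rule compactin_imp_closedin[OF G.Hausdorff_dual compactin_A[OF L]])
  ultimately have "dual_topology G T closure_of C \<subseteq> A L" by (rule closure_of_minimal)
  then show "compactin (dual_topology G T) (dual_topology G T closure_of C)"
    by (rule closed_compactin[OF compactin_A[OF L]]) simp
qed (rule G.topological_group_dual)

lemma evaluation_surj:
  assumes \<Phi>: "\<Phi> \<in> characters (dual_group G T) (dual_topology G T)"
  obtains x where "x \<in> carrier G" "\<And>f. f \<in> characters G T \<Longrightarrow> \<Phi> f = f x"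
proof -
  interpret dual: group_with_topology "dual_group G T" "dual_topology G T"
    by (rule G.group_with_topology_dual)
  note hom = charactersD(1)[OF \<Phi>]
  have "openin (dual_topology G T) {f \<in> topspace (dual_topology G T). \<Phi> f \<in> ball 1 1}"
    using charactersD(3)[OF \<Phi>] by (rule openin_continuous_map_preimage) simp
  moreover have "(\<lambda>x\<in>carrier G. 1) \<in> {f \<in> topspace (dual_topology G T). \<Phi> f \<in> ball 1 1}"
    using dual.circle_hom_one[OF hom] G.characters_one by simp
  ultimately obtain F e where F: "compactin T F" "e > 0"
    "{g \<in> characters G T. \<forall>x\<in>F. dist (g x) ((\<lambda>x\<in>carrier G. 1) x) < e}
      \<subseteq> {f \<in> topspace (dual_topology G T). \<Phi> f \<in> ball 1 1}"
    unfolding openin_dual_topology by blast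
  have F': "finite F" "F \<subseteq> carrier G"
    using finite_if_compactin[OF F(1)] compactin_subset_topspace[OF F(1)] topspace_T by auto
  have near: "norm (\<Phi> f - 1) < 1" if f: "f \<in> characters G T" "\<forall>x\<in>F. norm (f x - 1) < e" for f
  proof -
    have "f \<in> {g \<in> characters G T. \<forall>x\<in>F. dist (g x) ((\<lambda>x\<in>carrier G. 1) x) < e}"
      using f F'(2) by (auto simp: dist_norm subset_iff)
    then have "\<Phi> f \<in> ball 1 1" using F(3) by blast
    then show ?thesis by (simp add: dist_norm norm_minus_commute)
  qed
  \<comment> \<open>\<open>F\<close> is the same for all \<open>J\<close>: continuity of
    \<open>\<Phi>\<close> at the identity is used once and inherited by each
    \<open>A J\<close>.\<close>
  have local: "\<exists>x\<in>carrier G. \<forall>f\<in>A J. \<Phi> f = f x" if J: "countable J" "J \<subseteq> I" for J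
  proof -
    have char: "f \<in> characters G T" if "f \<in> A J" for f using A_characters[OF J] that by blast
    have "annihilator_character_axioms G (U J) \<Phi>"
      unfolding annihilator_character_axioms_def
    proof (intro conjI allI impI)
      show "subgroup (U J) G" by (rule subgroup_U[OF J(2)])
      show "norm (\<Phi> f) = 1" if "f \<in> A J" for f using dual.circle_hom_norm[OF hom] char[OF that] by simp
      show "\<Phi> (\<lambda>x\<in>carrier G. f x * g x) = \<Phi> f * \<Phi> g" if "f \<in> A J" "g \<in> A J" for f g
        using dual.circle_hom_mult[OF hom, of f g] char that by simp
    qed
    then have ac: "annihilator_character G (U J) \<Phi>"
      unfolding annihilator_character_def using comm_group_G by blast
    interpret annihilator_character G "U J" \<Phi> by (rule ac)
    show ?thesis
    proof (rule annihilator_character_is_evaluation[OF F'(1) ac F'(2)])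
      fix \<eta> :: real assume "\<eta> > 0"
      show "\<exists>d>0. \<forall>f\<in>A J. (\<forall>y\<in>F. norm (f y - 1) < d) \<longrightarrow> norm (\<Phi> f - 1) < \<eta>"
        by (rule \<Phi>_uniform_nbhd[OF F'(2) F(2) \<open>\<eta> > 0\<close>]) (rule near[OF char])
    qed
  qed
  \<comment> \<open>A representing point is determined only modulo \<open>U J\<close>, so each
    coordinate is read off from its own singleton.\<close>
  have "\<forall>i\<in>I. \<exists>x. x \<in> carrier G \<and> (\<forall>f\<in>A {i}. \<Phi> f = f x)"
  proof
    fix i assume "i \<in> I"
    then show "\<exists>x. x \<in> carrier G \<and> (\<forall>f\<in>A {i}. \<Phi> f = f x)" using local[of "{i}"] by auto
  qed
  from bchoice[OF this] obtain c where c: "\<forall>i\<in>I. c i \<in> carrier G \<and> (\<forall>f\<in>A {i}. \<Phi> f = f (c i))" ..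
  define x where "x = (\<lambda>i\<in>I. c i i)"
  have x: "x \<in> carrier G" unfolding carrier_G x_def using c G_coord by auto
  show thesis
  proof (rule that[OF x])
    fix f assume "f \<in> characters G T"
    then obtain J where J: "countable J" "J \<subseteq> I" "f \<in> A J" by (rule characters_A)
    obtain y where y: "y \<in> carrier G" "\<And>f. f \<in> A J \<Longrightarrow> \<Phi> f = f y" using local[OF J(1,2)] by blast
    \<comment> \<open>Characters in \<open>A {j}\<close> also belong to \<open>A J\<close>, so
      \<open>c j\<close> and \<open>y\<close> give them the same values; these characters separate
      the \<open>j\<close>-th coordinates.\<close>
    have "x j = y j" if j: "j \<in> J" for j
    proof (rule ccontr)
      assume ne: "x j \<noteq> y j"
      have jI: "j \<in> I" using j J(2) by blast
      have cj: "c j \<in> carrier G" "c j j \<noteq> y j" using c jI ne by (auto simp: x_def)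
      have jj: "{j} \<subseteq> I" using jI by simp
      obtain h where h: "h \<in> A {j}" "h (c j) \<noteq> h y"
        using A_separates_points[OF jj cj(1) y(1) _ cj(2)] by blast
      have "h \<in> A J" using h(1) A_mono[of "{j}" J] j by blast
      then have "\<Phi> h = h y" by (rule y(2))
      then show False using c jI h by simp
    qed
    then have "f x = f y" by (rule A_determined[OF J(2,3) x y(1)])
    then show "\<Phi> f = f x" using y(2)[OF J(3)] by simp
  qed
qed

lemma evaluation_bij:
  "bij_betw (evaluation_hom G T) (carrier G) (characters (dual_group G T) (dual_topology G T))"
proof (rule bij_betwI')
  fix x y assume xy: "x \<in> carrier G" "y \<in> carrier G"
  show "evaluation_hom G T x = evaluation_hom G T y \<longleftrightarrow> x = y"
  proof
    assume eq: "evaluation_hom G T x = evaluation_hom G T y"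
    show "x = y"
    proof (rule G_eqI[OF xy], rule ccontr)
      fix i assume i: "i \<in> I" "x i \<noteq> y i"
      then have J: "{i} \<subseteq> I" "countable {i}" by auto
      obtain f where f: "f \<in> A {i}" "f x \<noteq> f y" using A_separates_points[OF J(1) xy _ i(2)] by blast
      have "f \<in> characters G T" using f(1) A_characters[OF J(2,1)] by blast
      then show False using G.evaluation_apply[of f x] G.evaluation_apply[of f y] eq f(2) by simp
    qed
  qed simp
next
  fix \<Phi> assume \<Phi>: "\<Phi> \<in> characters (dual_group G T) (dual_topology G T)"
  obtain x where x: "x \<in> carrier G" "\<And>f. f \<in> characters G T \<Longrightarrow> \<Phi> f = f x"
    using evaluation_surj[OF \<Phi>] by blast
  have "\<Phi> = evaluation_hom G T x"
  proof (rule extensionalityI)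
    show "\<Phi> \<in> extensional (characters G T)" using charactersD(2)[OF \<Phi>] by simp
    show "evaluation_hom G T x \<in> extensional (characters G T)" by (simp add: evaluation_hom_def)
    show "\<Phi> f = evaluation_hom G T x f" if "f \<in> characters G T" for f
      using x(2)[OF that] G.evaluation_apply[OF that] by simp
  qed
  then show "\<exists>x\<in>carrier G. \<Phi> = evaluation_hom G T x" using x(1) by blast
qed (rule G.evaluation_character)

text \<open>Evaluation is open because each \<open>A J\<close> is a compact set of characters, and
  continuous because every compact set of characters lies in some \<open>A J\<close>.\<close>

lemma reflexive_G: "reflexive_group G T"
proof -
  let ?\<alpha> = "evaluation_hom G T"
  let ?T'' = "dual_topology (dual_group G T) (dual_topology G T)"
  let ?C = "characters (dual_group G T) (dual_topology G T)"
  have "homeomorphic_map T ?T'' ?\<alpha>"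
  proof (rule homeomorphic_map_if_open_iff)
    show "bij_betw ?\<alpha> (topspace T) (topspace ?T'')" using evaluation_bij by (simp add: topspace_T)
    fix S assume "S \<subseteq> topspace T"
    then have S: "S \<subseteq> carrier G" by (simp add: topspace_T)
    have "(\<exists>J. countable J \<and> J \<subseteq> I \<and> cylinder x J \<subseteq> S) \<longleftrightarrow>
      (\<exists>K e. compactin (dual_topology G T) K \<and> e > 0 \<and>
        {\<psi> \<in> ?C. \<forall>f\<in>K. dist (\<psi> f) (?\<alpha> x f) < e} \<subseteq> ?\<alpha> ` S)" (is "?L \<longleftrightarrow> ?R")
      if x: "x \<in> S" for x
    proof
      assume ?L
      then obtain J where J: "countable J" "J \<subseteq> I" "cylinder x J \<subseteq> S" by blast
      have xc: "x \<in> carrier G" using x S by blast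
      \<comment> \<open>Radius 1 suffices because \<open>A J\<close> is closed under powers: for the
        quotient \<open>z\<close> of \<open>y\<close> and \<open>x\<close>, all powers of
        \<open>f z\<close> stay within distance 1 of 1, which forces \<open>f z = 1\<close>.\<close>
      have "{\<psi> \<in> ?C. \<forall>f\<in>A J. dist (\<psi> f) (?\<alpha> x f) < 1} \<subseteq> ?\<alpha> ` S"
      proof
        fix \<psi> assume \<psi>: "\<psi> \<in> {\<psi> \<in> ?C. \<forall>f\<in>A J. dist (\<psi> f) (?\<alpha> x f) < 1}"
        then obtain y where y: "y \<in> carrier G" "\<psi> = ?\<alpha> y"
          using evaluation_bij by (auto simp: bij_betw_def)
        have close: "norm (f y - f x) < 1" if "f \<in> A J" for f
        proof -
          have "f \<in> characters G T" using that A_characters[OF J(1,2)] by blast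
          then have "\<psi> f = f y" "?\<alpha> x f = f x" using y(2) G.evaluation_apply by auto
          then show ?thesis using \<psi> that by (auto simp: dist_norm)
        qed
        interpret UJ: subgroup "U J" G by (rule subgroup_U[OF J(2)])
        define z where "z = y \<otimes>\<^bsub>G\<^esub> inv\<^bsub>G\<^esub> x"
        have z: "z \<in> carrier G" using xc y(1) by (simp add: z_def)
        have "z \<in> U J"
        proof (rule ccontr)
          assume "z \<notin> U J"
          then obtain f where f: "f \<in> A J" "f z \<noteq> 1" using A_separates[OF J(2) z] by blast
          note hom = G.annihilatorD(1)[OF f(1)]
          have "f z = 1"
          proof (rule unit_eq_one_if_powers_near_one)
            show "norm (f z) = 1" by (rule G.circle_hom_norm[OF hom z])
            fix n :: nat
            define h where "h = (\<lambda>x\<in>carrier G. f x ^ n)"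
            have h: "h \<in> A J" unfolding h_def by (rule G.annihilator_power[OF f(1) U_subset])
            note hh = G.annihilatorD(1)[OF h]
            have "f z ^ n = h z" using z by (simp add: h_def)
            also have "\<dots> = h y * inverse (h x)"
              unfolding z_def using G.circle_hom_mult[OF hh y(1) G.inv_closed[OF xc]] G.circle_hom_inv[OF hh xc] by simp
            finally have eq: "f z ^ n - 1 = (h y - h x) * inverse (h x)"
              using G.circle_hom_nonzero[OF hh xc] by (simp add: left_diff_distrib)
            show "norm (f z ^ n - 1) < 1"
              unfolding eq using close[OF h] G.circle_hom_norm[OF hh xc] by (simp add: norm_mult norm_inverse)
          qed
          then show False using f(2) by blast
        qed
        then have "y \<in> cylinder x J"
          using U_quotient_iff[OF J(2) y(1) xc] y(1) by (auto simp: z_def cylinder_def)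
        then show "\<psi> \<in> ?\<alpha> ` S" using J(3) y(2) by blast
      qed
      then show ?R using compactin_A[OF J(1,2)] by (intro exI[of _ "A J"] exI[of _ "1::real"]) simp
    next
      assume ?R
      then obtain K e where K: "compactin (dual_topology G T) K" "e > 0"
        "{\<psi> \<in> ?C. \<forall>f\<in>K. dist (\<psi> f) (?\<alpha> x f) < e} \<subseteq> ?\<alpha> ` S" by blast
      obtain J where J: "countable J" "J \<subseteq> I" "K \<subseteq> A J"
        using compact_characters_countable_support[OF K(1)] by blast
      have xc: "x \<in> carrier G" using x S by blast
      have "cylinder x J \<subseteq> S"
      proof
        fix y assume y: "y \<in> cylinder x J"
        then have yc: "y \<in> carrier G" by (simp add: cylinder_def)
        have "?\<alpha> y f = ?\<alpha> x f" if f: "f \<in> K" for f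
        proof -
          have "f y = f x"
            using y J(3) f by (intro A_determined[OF J(2) _ yc xc]) (auto simp: cylinder_def)
          moreover have "f \<in> characters G T" using f J(3) A_characters[OF J(1,2)] by blast
          ultimately show ?thesis by (simp add: G.evaluation_apply)
        qed
        then have "?\<alpha> y \<in> ?\<alpha> ` S" using K(2,3) G.evaluation_character[OF yc] by auto
        then obtain s where s: "s \<in> S" "?\<alpha> y = ?\<alpha> s" by blast
        have "y = s"
          using inj_onD[OF bij_betw_imp_inj_on[OF evaluation_bij] s(2) yc] s(1) S by blast
        then show "y \<in> S" using s(1) by simp
      qed
      then show ?L using J by blast
    qed
    moreover have "?\<alpha> ` S \<subseteq> ?C" using S G.evaluation_character by blast
    ultimately show "openin T S \<longleftrightarrow> openin ?T'' (?\<alpha> ` S)"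
      unfolding openin_T openin_dual_topology[of "dual_group G T"] using S by simp
  qed
  moreover have "?\<alpha> \<in> iso G (bidual_group G T)"
    using G.evaluation_hom_hom evaluation_bij by (simp add: iso_def bidual_group_def)
  ultimately show ?thesis
    unfolding reflexive_group_def bidual_topology_def using comm_group_G topological_group_G by blast
qed

section \<open>Nondiscreteness and noncompactness\<close>

lemma nontrivial_in_U:
  assumes "uncountable I" "countable J" "J \<subseteq> I"
    and nontrivial: "\<And>i. i \<in> I \<Longrightarrow> carrier (D i) \<noteq> {\<one>\<^bsub>D i\<^esub>}"
  obtains i x where "i \<in> I" "x \<in> U J" "x i \<noteq> \<one>\<^bsub>D i\<^esub>"
proof -
  obtain i where i: "i \<in> I" "i \<notin> J" using assms(1,2,3) by (metis subsetI subset_antisym)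
  have one: "\<one>\<^bsub>D j\<^esub> \<in> carrier (D j)" if "j \<in> I" for j
    using monoid.one_closed[OF group.is_monoid[OF factor_group[OF that]]] .
  obtain a where a: "a \<in> carrier (D i)" "a \<noteq> \<one>\<^bsub>D i\<^esub>" using nontrivial[OF i(1)] one[OF i(1)] by blast
  define x where "x = (\<lambda>j\<in>I. if j = i then a else \<one>\<^bsub>D j\<^esub>)"
  have "x \<in> carrier G" unfolding carrier_G x_def using a(1) one by auto
  then have "x \<in> U J" using i(2) assms(3) by (auto simp: U_iff x_def)
  moreover have "x i \<noteq> \<one>\<^bsub>D i\<^esub>" using a(2) i(1) by (simp add: x_def)
  ultimately show thesis using that i(1) by blast
qed

lemma not_discrete:
  assumes "uncountable I" and "\<And>i. i \<in> I \<Longrightarrow> carrier (D i) \<noteq> {\<one>\<^bsub>D i\<^esub>}"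
  shows "T \<noteq> discrete_topology (carrier G)"
proof
  assume "T = discrete_topology (carrier G)"
  then have "openin T {\<one>\<^bsub>G\<^esub>}" by simp
  then obtain J where J: "countable J" "J \<subseteq> I" "U J \<subseteq> {\<one>\<^bsub>G\<^esub>}" unfolding openin_T U_def by blast
  obtain i x where "i \<in> I" "x \<in> U J" "x i \<noteq> \<one>\<^bsub>D i\<^esub>"
    using nontrivial_in_U[OF assms(1) J(1,2) assms(2)] by blast
  then show False using J(3) G_one_apply by auto
qed

lemma dual_not_compact:
  assumes "uncountable I" and "\<And>i. i \<in> I \<Longrightarrow> carrier (D i) \<noteq> {\<one>\<^bsub>D i\<^esub>}"
  shows "\<not> compact_space (dual_topology G T)"
proof
  assume "compact_space (dual_topology G T)"
  then have "compactin (dual_topology G T) (characters G T)" by (simp add: compact_space_def)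
  then obtain J where J: "countable J" "J \<subseteq> I" "characters G T \<subseteq> A J"
    using compact_characters_countable_support by blast
  obtain i x where ix: "i \<in> I" "x \<in> U J" "x i \<noteq> \<one>\<^bsub>D i\<^esub>"
    using nontrivial_in_U[OF assms(1) J(1,2) assms(2)] by blast
  have i: "{i} \<subseteq> I" "countable {i}" using ix(1) by auto
  have "x \<in> carrier G" "x \<notin> U {i}" using ix U_subset U_iff[OF i(1)] by auto
  \<comment> \<open>A continuous character that is not 1 at \<open>x\<close> cannot belong to
    \<open>A J\<close>, since \<open>x\<close> lies in \<open>U J\<close>.\<close>
  then obtain f where f: "f \<in> A {i}" "f x \<noteq> 1" using A_separates[OF i(1)] by blast
  have "f \<in> A J" using f(1) A_characters[OF i(2,1)] J(3) by blast
  then show False using G.annihilatorD(2)[OF _ ix(2)] f(2) by blast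
qed

end

theorem theorem3:
  fixes I :: "'i set" and D :: "'i \<Rightarrow> 'a monoid"
  assumes "uncountable I"
    and "\<And>i. i \<in> I \<Longrightarrow> comm_group (D i)"
    and "\<And>i. i \<in> I \<Longrightarrow> carrier (D i) \<noteq> {\<one>\<^bsub>D i\<^esub>}"
  defines "G \<equiv> product_group I D"
    and "T \<equiv> P_modification (product_topology (\<lambda>i. discrete_topology (carrier (D i))) I)"
  shows "P_group G T \<and> T \<noteq> discrete_topology (carrier G) \<and>
    omega_bounded_group (dual_group G T) (dual_topology G T) \<and>
    \<not> compact_space (dual_topology G T) \<and>
    reflexive_group G T \<and>
    reflexive_group (dual_group G T) (dual_topology G T)"
proof -
  interpret P: discrete_product I D by (rule discrete_product.intro) (rule assms(2))
  have "G = P.G" "T = P.T" by (simp_all only: G_def T_def P.G_def P.T_def)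
  then show ?thesis
    using P.P_group_G P.not_discrete[OF assms(1,3)] P.omega_bounded_dual
      P.dual_not_compact[OF assms(1,3)] P.reflexive_G reflexive_dual[OF P.reflexive_G] by simp
qed

end
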